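(* Let $d>0$ and let $\Omega$ be the open ball of $\mathbb{R}^n$ of radius $d/2$ centered at $0$. There is a constant $C_1$ depending on $\Omega$ such that the following holds. Assume $f,g\in L^2_r(\Omega)$, $f\ge0$ and $g\ge0$ a.e. in $\Omega$, $a\in W^{1,\infty}(\mathbb{R})$ and $\inf_{\mathbb{R}}a>0$. Assume that there is a solution $\mu_d$ of the equation $\mu\,a(\mu)=l_d(\phi)$ such that $$a(\mu_d)=\min_{[0,\mu_d]}a\qquad\text{and}\qquad a(0)=\max_{[0,\mu_d]}a .$$ Let $u^1_d$ be the smallest solution of $(P_d)$, and assume $0\le l_d(u_d^1)\le\mu_d$. Assume in addition that for some $\epsilon>0$ $$C_1\,|g|_2\,|f|_2\,|a'|_{\infty,[-\epsilon,\mu_d+\epsilon]}\,\frac{1}{a(\mu_d)^2}<1.$$ Then the global branch of solutions $\{(r,u_r):r\in[0,d]\}$ is composed of stable solutions, i.e. for every $r\in[0,d]$, $$\int_\Omega a(l_r(u_r))|\nabla\psi|^2\,dx-\int_\Omega a'(l_r(u_r))\,l_r(\psi)\,\nabla u_r\cdot\nabla\psi\,dx\ \ge 0\qquad\text{for all }\psi\in H^1_0(\Omega).$$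
   Context: $L^2_r(\Omega)$ denotes the set of radial functions $u\in L^2(\Omega)$, i.e. those for which there is $\tilde u\in L^2(]0,d/2[)$ with $u(x)=\tilde u(\|x\|)$ (the subscript stands for "radial"). For $r\in[0,d]$ and $v\in L^2(\Omega)$, $l_r(v)(x)=\int_{\Omega\cap B(x,r)}g(y)v(y)\,dy$, with $B(x,r)$ the closed ball of center $x$ and radius $r$ (so $l_0(v)=0$ and $l_d(v)=\int_\Omega gv$ is a constant). $(P_r)$ is the problem $-\mathrm{div}(a(l_r(u))\nabla u)=f$ in $\Omega$, $u\in H^1_0(\Omega)$, understood weakly. $\phi\in H^1_0(\Omega)$ is the weak solution of $-\Delta\phi=f$ in $\Omega$. The solutions of $(P_d)$ correspond to the real solutions $\mu$ of $\mu\,a(\mu)=l_d(\phi)$ through $\mu=l_d(u)$, i.e. $u=\phi/a(\mu)$. $|\cdot|_2$ is the $L^2(\Omega)$ norm and $|a'|_{\infty,J}$ the $L^\infty$ norm of $a'$ on the interval $J$. Denote by $u_0$ the solution of $(P_0)$ and by $u_d$ the solution of $(P_d)$ associated with $\mu_d$. For $r\in[0,d]$, $u_r$ denotes the unique radial solution of $(P_r)$ in the order interval $[u_0,u_d]$ (its existence and uniqueness are known from earlier work), satisfying $0\le l_r(u_r)\le\mu_d$ a.e. in $\Omega$. A global branch of solutions is (the graph of) a map $u\in C([0,d],H^1_0(\Omega))$ such that $u(r)$ is a solution of $(P_r)$ for every $r\in[0,d]$; the branch considered is $r\mapsto u_r$. *)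

theory Defs
  imports "HOL-Probability.Essential_Supremum"
begin

section \<open>Lebesgue spaces\<close>

text \<open>Elements of Lebesgue and Sobolev spaces are represented by functions; equalities and
  inequalities between them are understood almost everywhere.\<close>

definition L2 :: "'a::euclidean_space set \<Rightarrow> ('a \<Rightarrow> 'b::euclidean_space) \<Rightarrow> bool" where
  "L2 \<Omega> u \<longleftrightarrow> u \<in> borel_measurable (lebesgue_on \<Omega>) \<and>
     integrable (lebesgue_on \<Omega>) (\<lambda>x. (norm (u x))\<^sup>2)"

definition L2_norm :: "'a::euclidean_space set \<Rightarrow> ('a \<Rightarrow> 'b::euclidean_space) \<Rightarrow> real" where
  "L2_norm \<Omega> u = sqrt (\<integral>x. (norm (u x))\<^sup>2 \<partial>lebesgue_on \<Omega>)"

definition Linf_norm :: "'a::euclidean_space set \<Rightarrow> ('a \<Rightarrow> real) \<Rightarrow> ereal" where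
  "Linf_norm S h = esssup (lebesgue_on S) (\<lambda>t. ereal \<bar>h t\<bar>)"

definition Linf :: "'a::euclidean_space set \<Rightarrow> ('a \<Rightarrow> real) \<Rightarrow> bool" where
  "Linf S h \<longleftrightarrow> h \<in> borel_measurable (lebesgue_on S) \<and> Linf_norm S h < \<infinity>"

text \<open>Radial functions on the ball of diameter \<open>d\<close>; the profile is square integrable on
  \<open>]0,d/2[\<close> for the unweighted one-dimensional Lebesgue measure.\<close>

definition L2_radial :: "real \<Rightarrow> ('a::euclidean_space \<Rightarrow> real) \<Rightarrow> bool" where
  "L2_radial d u \<longleftrightarrow> L2 (ball 0 (d/2)) u \<and>
     (\<exists>w :: real \<Rightarrow> real. L2 {0<..<d/2} w \<and>
        (AE x in lebesgue_on (ball 0 (d/2)). u x = w (norm x)))"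


section \<open>Weak derivatives and Sobolev spaces\<close>

definition gradient :: "('a::euclidean_space \<Rightarrow> real) \<Rightarrow> 'a \<Rightarrow> 'a" where
  "gradient f x = (\<Sum>i\<in>Basis. frechet_derivative f (at x) i *\<^sub>R i)"

primrec Ck :: "nat \<Rightarrow> ('a::euclidean_space \<Rightarrow> real) \<Rightarrow> bool" where
  "Ck 0 f \<longleftrightarrow> continuous_on UNIV f"
| "Ck (Suc k) f \<longleftrightarrow> (\<forall>x. f differentiable (at x)) \<and> (\<forall>i\<in>Basis. Ck k (\<lambda>x. gradient f x \<bullet> i))"

text \<open>The space $C_c^\infty(\Omega)$; test functions are extended by \<open>0\<close> to the whole space.\<close>

definition test_function :: "'a::euclidean_space set \<Rightarrow> ('a \<Rightarrow> real) \<Rightarrow> bool" where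
  "test_function \<Omega> \<phi> \<longleftrightarrow> (\<forall>k. Ck k \<phi>) \<and>
     (\<exists>K. compact K \<and> K \<subseteq> \<Omega> \<and> (\<forall>x. x \<notin> K \<longrightarrow> \<phi> x = 0))"

definition has_weak_gradient ::
  "'a::euclidean_space set \<Rightarrow> ('a \<Rightarrow> real) \<Rightarrow> ('a \<Rightarrow> 'a) \<Rightarrow> bool" where
  "has_weak_gradient \<Omega> u Du \<longleftrightarrow>
     (\<forall>\<phi>. test_function \<Omega> \<phi> \<longrightarrow> (\<forall>i\<in>Basis.
        (\<integral>x. u x * (gradient \<phi> x \<bullet> i) \<partial>lebesgue_on \<Omega>) =
        - (\<integral>x. (Du x \<bullet> i) * \<phi> x \<partial>lebesgue_on \<Omega>)))"

text \<open>\<open>H10 \<Omega> u Du\<close>: $u \in H^1_0(\Omega)$ with $\nabla u = Du$, where $H^1_0(\Omega)$ is the closure of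
  $C_c^\infty(\Omega)$ in $H^1(\Omega)$. Carrying \<open>Du\<close> along avoids choosing a representative of the
  weak gradient, which \<open>u\<close> determines almost everywhere.\<close>

definition H10 :: "'a::euclidean_space set \<Rightarrow> ('a \<Rightarrow> real) \<Rightarrow> ('a \<Rightarrow> 'a) \<Rightarrow> bool" where
  "H10 \<Omega> u Du \<longleftrightarrow> L2 \<Omega> u \<and> L2 \<Omega> Du \<and> has_weak_gradient \<Omega> u Du \<and>
     (\<exists>\<phi> :: nat \<Rightarrow> 'a \<Rightarrow> real. (\<forall>k. test_function \<Omega> (\<phi> k)) \<and>
        (\<lambda>k. \<integral>x. (u x - \<phi> k x)\<^sup>2 + (norm (Du x - gradient (\<phi> k) x))\<^sup>2 \<partial>lebesgue_on \<Omega>)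
          \<longlonglongrightarrow> 0)"

text \<open>\<open>W1inf a a'\<close>: $a \in W^{1,\infty}(\mathbb{R})$ with weak derivative \<open>a'\<close>. As the pointwise values of
  \<open>a\<close> matter, \<open>a\<close> is its continuous representative.

  The composition of \<open>a'\<close> with $l_r(u)$ depends on the representative of \<open>a'\<close>, because $l_r(u)$ may
  be constant on a set of positive measure (for \<open>r = d\<close> it is constant on \<open>\<Omega>\<close>). The representative
  is fixed to be the pointwise derivative of \<open>a\<close>, extended by \<open>0\<close> to the null set where \<open>a\<close> is not
  differentiable; by Lebesgue's differentiation theorem this is a representative of the weak
  derivative of every $a \in W^{1,\infty}(\mathbb{R})$.\<close>

definition W1inf :: "(real \<Rightarrow> real) \<Rightarrow> (real \<Rightarrow> real) \<Rightarrow> bool" where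
  "W1inf a a' \<longleftrightarrow> continuous_on UNIV a \<and> Linf UNIV a \<and> Linf UNIV a' \<and>
     has_weak_gradient UNIV a a' \<and>
     (\<forall>t. a' t = (if a differentiable (at t) then deriv a t else 0))"


section \<open>The nonlocal problem\<close>

text \<open>$l_r(v)(x)$, and its constant value $l_d(v)$ on the ball \<open>\<Omega>\<close> of diameter \<open>d\<close>.\<close>

definition l_op ::
  "'a::euclidean_space set \<Rightarrow> ('a \<Rightarrow> real) \<Rightarrow> real \<Rightarrow> ('a \<Rightarrow> real) \<Rightarrow> 'a \<Rightarrow> real" where
  "l_op \<Omega> g r v x = (\<integral>y. g y * v y \<partial>lebesgue_on (\<Omega> \<inter> cball x r))"

definition l_full :: "'a::euclidean_space set \<Rightarrow> ('a \<Rightarrow> real) \<Rightarrow> ('a \<Rightarrow> real) \<Rightarrow> real" where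
  "l_full \<Omega> g v = (\<integral>y. g y * v y \<partial>lebesgue_on \<Omega>)"

text \<open>Weak solutions $u \in H^1_0(\Omega)$ of $-\mathrm{div}(c\nabla u) = f$, with $\nabla u = Du$.\<close>

definition weak_solution ::
  "'a::euclidean_space set \<Rightarrow> ('a \<Rightarrow> real) \<Rightarrow> ('a \<Rightarrow> real) \<Rightarrow> ('a \<Rightarrow> real) \<Rightarrow> ('a \<Rightarrow> 'a) \<Rightarrow> bool" where
  "weak_solution \<Omega> c f u Du \<longleftrightarrow> H10 \<Omega> u Du \<and>
     (\<forall>v Dv. H10 \<Omega> v Dv \<longrightarrow>
        (\<integral>x. c x * (Du x \<bullet> Dv x) \<partial>lebesgue_on \<Omega>) = (\<integral>x. f x * v x \<partial>lebesgue_on \<Omega>))"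

definition solves_P ::
  "'a::euclidean_space set \<Rightarrow> (real \<Rightarrow> real) \<Rightarrow> ('a \<Rightarrow> real) \<Rightarrow> ('a \<Rightarrow> real) \<Rightarrow> real \<Rightarrow>
   ('a \<Rightarrow> real) \<Rightarrow> ('a \<Rightarrow> 'a) \<Rightarrow> bool" where
  "solves_P \<Omega> a g f r u Du \<longleftrightarrow> weak_solution \<Omega> (\<lambda>x. a (l_op \<Omega> g r u x)) f u Du"

definition smallest_solution_P ::
  "'a::euclidean_space set \<Rightarrow> (real \<Rightarrow> real) \<Rightarrow> ('a \<Rightarrow> real) \<Rightarrow> ('a \<Rightarrow> real) \<Rightarrow> real \<Rightarrow>
   ('a \<Rightarrow> real) \<Rightarrow> ('a \<Rightarrow> 'a) \<Rightarrow> bool" where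
  "smallest_solution_P \<Omega> a g f r u Du \<longleftrightarrow> solves_P \<Omega> a g f r u Du \<and>
     (\<forall>v Dv. solves_P \<Omega> a g f r v Dv \<longrightarrow> (AE x in lebesgue_on \<Omega>. u x \<le> v x))"

definition order_interval ::
  "'a::euclidean_space set \<Rightarrow> ('a \<Rightarrow> real) \<Rightarrow> ('a \<Rightarrow> real) \<Rightarrow> ('a \<Rightarrow> real) set" where
  "order_interval \<Omega> v w = {u. AE x in lebesgue_on \<Omega>. v x \<le> u x \<and> u x \<le> w x}"

text \<open>A global branch: $u \in C([0,d],H^1_0(\Omega))$ with \<open>u r\<close> a solution of $(P_r)$ for all \<open>r\<close>.\<close>

definition global_branch ::
  "'a::euclidean_space set \<Rightarrow> real \<Rightarrow> (real \<Rightarrow> real) \<Rightarrow> ('a \<Rightarrow> real) \<Rightarrow> ('a \<Rightarrow> real) \<Rightarrow>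
   (real \<Rightarrow> 'a \<Rightarrow> real) \<Rightarrow> (real \<Rightarrow> 'a \<Rightarrow> 'a) \<Rightarrow> bool" where
  "global_branch \<Omega> d a g f u Du \<longleftrightarrow>
     (\<forall>r\<in>{0..d}. solves_P \<Omega> a g f r (u r) (Du r)) \<and>
     (\<forall>s\<in>{0..d}.
        ((\<lambda>r. \<integral>x. (u r x - u s x)\<^sup>2 + (norm (Du r x - Du s x))\<^sup>2 \<partial>lebesgue_on \<Omega>) \<longlongrightarrow> 0)
          (at s within {0..d}))"

definition stable_solution ::
  "'a::euclidean_space set \<Rightarrow> (real \<Rightarrow> real) \<Rightarrow> (real \<Rightarrow> real) \<Rightarrow> ('a \<Rightarrow> real) \<Rightarrow> real \<Rightarrow>
   ('a \<Rightarrow> real) \<Rightarrow> ('a \<Rightarrow> 'a) \<Rightarrow> bool" where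
  "stable_solution \<Omega> a a' g r u Du \<longleftrightarrow>
     (\<forall>\<psi> D\<psi>. H10 \<Omega> \<psi> D\<psi> \<longrightarrow>
        (\<integral>x. a (l_op \<Omega> g r u x) * (norm (D\<psi> x))\<^sup>2 \<partial>lebesgue_on \<Omega>)
        - (\<integral>x. a' (l_op \<Omega> g r u x) * l_op \<Omega> g r \<psi> x * (Du x \<bullet> D\<psi> x) \<partial>lebesgue_on \<Omega>) \<ge> 0)"

end

theory Submission
  imports Defs "HOL-Computational_Algebra.Polynomial"
begin

text \<open>Testing the weak gradient of $u \in H^1_0$ against $x_i u$ gives the Poincare inequality
  $|u|_2 \le d\,|\nabla u|_2$ on the ball of diameter \<open>d\<close>, and $C_1 = d^2$ works. The maximum
  principle (testing with a smooth function of $u_0$ that is positive exactly where $u_0 < 0$)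
  gives $0 \le u_0 \le u_r \le u_d$, hence $0 \le l_r(u_r) \le \mu_d$ everywhere. So the diffusion
  coefficient is at least $a(\mu_d)$, and the energy estimate reads
  $|\nabla u_r|_2 \le d\,|f|_2 / a(\mu_d)$. With $K = |a'|_\infty$ and
  $|l_r(\psi)| \le |g|_2 |\psi|_2$, the nonlocal term is at most
  $K |g|_2\, d\, |\nabla u_r|_2 |\nabla\psi|_2^2 \le a(\mu_d) |\nabla\psi|_2^2$. Since $l_r(u_r)$
  may be constant on large sets, the bound $|a'| \le K$ is needed at every point of $[0,\mu_d]$,
  not only almost everywhere.\<close>

section \<open>Calculus of the classes \<open>Ck\<close> and a flat function\<close>

text \<open>Since \<open>H10\<close> is a closure of smooth compactly supported functions, a test
  function built from a solution must again be a limit of such functions. The negative part is not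
  smooth, so the function exp(1/t) for t < 0, extended by 0, takes its place: composition keeps
  compact supports because the value at 0 is 0, and it acts on \<open>H10\<close> because its first
  derivative is bounded and continuous. Only \<open>u0\<close> needs a maximum principle. At radius
  0 the nonlocal term vanishes, so the coefficient is the constant a(0), and the order interval
  passes the sign on to every member of the branch. All integrations by parts rest on one fact:
  partial derivatives of a test function have integral 0. For the pointwise bound on
  \<open>a'\<close>, the weak derivative is averaged against bumps shrinking to one point. The
  averages are bounded by the essential supremum and converge to the classical derivative
  there.\<close>

lemma gradient_inner_Basis:
  assumes "(f has_derivative f') (at x)" "i \<in> Basis"
  shows "gradient f x \<bullet> i = f' i"
  using assms frechet_derivative_at[OF assms(1)]
  by (simp add: gradient_def inner_sum_left inner_Basis if_distrib sum.delta cong: if_cong)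

lemma has_derivative_gradient:
  assumes "f differentiable (at x)"
  shows "(f has_derivative (\<lambda>h. gradient f x \<bullet> h)) (at x)"
proof -
  obtain f' where f': "(f has_derivative f') (at x)"
    using assms by (auto simp: differentiable_def)
  interpret f': bounded_linear f'
    using f' by (rule has_derivative_bounded_linear)
  have "f' h = gradient f x \<bullet> h" for h
  proof -
    have "f' h = f' (\<Sum>i\<in>Basis. (h \<bullet> i) *\<^sub>R i)"
      by (simp add: euclidean_representation)
    also have "\<dots> = (\<Sum>i\<in>Basis. (h \<bullet> i) * f' i)"
      by (simp add: f'.sum f'.scaleR)
    also have "\<dots> = (\<Sum>i\<in>Basis. (gradient f x \<bullet> i) * (h \<bullet> i))"
      using gradient_inner_Basis[OF f'] by (intro sum.cong) auto
    also have "\<dots> = gradient f x \<bullet> h"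
      by (simp add: euclidean_inner[symmetric])
    finally show ?thesis .
  qed
  then have "f' = (\<lambda>h. gradient f x \<bullet> h)" by blast
  then show ?thesis using f' by simp
qed

lemma Ck_imp_continuous_on: "Ck k f \<Longrightarrow> continuous_on UNIV f"
  by (cases k) (auto simp: continuous_on_eq_continuous_at differentiable_imp_continuous_within)

lemma Ck_Suc_imp_Ck: "Ck (Suc k) f \<Longrightarrow> Ck k f"
proof (induction k arbitrary: f)
  case 0
  then show ?case using Ck_imp_continuous_on[of "Suc 0" f] by simp
next
  case (Suc k)
  show ?case
    using Suc.prems Suc.IH
    by (metis Ck.simps(2))
qed

text \<open>Reduces smoothness to exhibiting a derivative in any form, so \<open>gradient\<close>
  never has to be computed.\<close>

lemma Ck_SucI:
  assumes "\<And>x. (f has_derivative f' x) (at x)"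
    and "\<And>i. i \<in> Basis \<Longrightarrow> Ck k (\<lambda>x. f' x i)"
  shows "Ck (Suc k) f"
proof -
  have "(\<lambda>x. gradient f x \<bullet> i) = (\<lambda>x. f' x i)" if "i \<in> Basis" for i
    using gradient_inner_Basis[OF assms(1) that] by auto
  then show ?thesis
    using assms by (auto simp: differentiable_def)
qed

lemma Ck_const: "Ck k (\<lambda>x. c)"
  by (induction k arbitrary: c) (auto simp del: Ck.simps(2) intro!: Ck_SucI[where f'="\<lambda>_ _. 0"])

lemma Ck_inner_left: "Ck k (\<lambda>x. x \<bullet> b)"
proof (cases k)
  case (Suc m)
  show ?thesis unfolding Suc
    by (rule Ck_SucI[where f'="\<lambda>_ h. h \<bullet> b"]) (auto intro!: derivative_eq_intros Ck_const)
qed (auto intro!: continuous_intros)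

lemma Ck_add: "Ck k f \<Longrightarrow> Ck k g \<Longrightarrow> Ck k (\<lambda>x. f x + g x)"
proof (induction k arbitrary: f g)
  case 0
  then show ?case by (auto intro: continuous_intros)
next
  case (Suc k)
  show ?case
  proof (rule Ck_SucI)
    show "((\<lambda>x. f x + g x) has_derivative (\<lambda>h. gradient f x \<bullet> h + gradient g x \<bullet> h)) (at x)" for x
      using Suc.prems by (auto intro!: has_derivative_add has_derivative_gradient)
  qed (use Suc in auto)
qed

lemma Ck_mult: "Ck k f \<Longrightarrow> Ck k g \<Longrightarrow> Ck k (\<lambda>x. f x * g x)"
proof (induction k arbitrary: f g)
  case 0
  then show ?case by (auto intro: continuous_intros)
next
  case (Suc k)
  show ?case
  proof (rule Ck_SucI)
    show "((\<lambda>x. f x * g x) has_derivative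
        (\<lambda>h. f x * (gradient g x \<bullet> h) + (gradient f x \<bullet> h) * g x)) (at x)" for x
      using Suc.prems by (auto intro!: has_derivative_mult has_derivative_gradient)
    show "Ck k (\<lambda>x. f x * (gradient g x \<bullet> i) + (gradient f x \<bullet> i) * g x)" if "i \<in> Basis" for i
      using Suc.prems that by (intro Ck_add Suc.IH Ck_Suc_imp_Ck[of k f] Ck_Suc_imp_Ck[of k g]) auto
  qed
qed

text \<open>The whole sequence of derivatives \<open>H j\<close> is carried along with
  \<open>j\<close> arbitrary: the chain rule turns \<open>H j\<close> into \<open>H (Suc j)\<close>
  times a partial derivative of \<open>f\<close>, and the induction hypothesis is needed at
  \<open>Suc j\<close>.\<close>

lemma Ck_compose:
  assumes "\<And>j t. (H j has_real_derivative H (Suc j) t) (at t)"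
  shows "Ck k f \<Longrightarrow> Ck k (\<lambda>x. H j (f x))"
proof (induction k arbitrary: f j)
  case 0
  have "continuous_on UNIV (H j)"
    using assms by (auto intro!: continuous_at_imp_continuous_on DERIV_isCont)
  then show ?case
    using 0 by (auto intro: continuous_on_compose2)
next
  case (Suc k)
  show ?case
  proof (rule Ck_SucI)
    show "((\<lambda>x. H j (f x)) has_derivative (\<lambda>h. H (Suc j) (f x) * (gradient f x \<bullet> h))) (at x)" for x
      using Suc.prems
      by (auto intro!: has_derivative_compose[OF has_derivative_gradient]
          assms[unfolded has_field_derivative_def])
    show "Ck k (\<lambda>x. H (Suc j) (f x) * (gradient f x \<bullet> i))" if "i \<in> Basis" for i
      using Suc.prems that by (intro Ck_mult Suc.IH Ck_Suc_imp_Ck[of k f]) auto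
  qed
qed

text \<open>With s = 1/t, the t-derivative of p(s) exp(s) is -s^2 (p'(s) + p(s)) exp(s); the
  polynomial \<open>[:0, 0, 1:]\<close> is s^2.\<close>

primrec flat_poly :: "nat \<Rightarrow> real poly" where
  "flat_poly 0 = 1"
| "flat_poly (Suc j) = - [:0, 0, 1:] * (pderiv (flat_poly j) + flat_poly j)"

text \<open>The mirror image of the classical flat function exp(-1/t) on t > 0, together with all
  its derivatives: \<open>flat j\<close> is the derivative of order \<open>j\<close> of
  \<open>flat 0\<close>.\<close>

definition flat :: "nat \<Rightarrow> real \<Rightarrow> real" where
  "flat j t = (if t < 0 then poly (flat_poly j) (inverse t) * exp (inverse t) else 0)"

text \<open>The extra power \<open>inverse t ^ n\<close> makes induction on the polynomial possible:
  a + s p(s) splits into a constant term and the same claim for p with exponent n + 1. The case n =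
  1 is the one used for difference quotients at 0.\<close>

lemma tendsto_poly_inverse_exp_at_left_0:
  "((\<lambda>t::real. inverse t ^ n * poly p (inverse t) * exp (inverse t)) \<longlongrightarrow> 0) (at_left 0)"
proof (induction p arbitrary: n)
  case 0
  then show ?case by simp
next
  case (pCons a p)
  have "((\<lambda>s::real. s ^ n / exp s) \<longlongrightarrow> 0) at_top"
    by (rule tendsto_power_div_exp_0)
  moreover have "filterlim (\<lambda>t::real. - inverse t) at_top (at_left 0)"
    by (rule filterlim_compose[OF filterlim_uminus_at_top_at_bot filterlim_inverse_at_bot_neg])
  ultimately have "((\<lambda>t::real. (- inverse t) ^ n / exp (- inverse t)) \<longlongrightarrow> 0) (at_left 0)"
    by (rule filterlim_compose)
  then have "((\<lambda>t::real. a * (- 1) ^ n * ((- inverse t) ^ n / exp (- inverse t))) \<longlongrightarrow> a * (- 1) ^ n * 0)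
      (at_left 0)"
    by (intro tendsto_intros)
  \<comment> \<open>The known limit is along -1/t, which tends to plus infinity; the two signs
    cancel.\<close>
  moreover have "(- 1) ^ n * ((- s) ^ n / exp (- s)) = s ^ n * exp s" for s :: real
    by (simp add: exp_minus field_simps) (simp flip: power_mult_distrib)
  ultimately have "((\<lambda>t::real. a * (inverse t ^ n * exp (inverse t))) \<longlongrightarrow> 0) (at_left 0)"
    by (simp only: mult.assoc mult_zero_right)
  from tendsto_add[OF this pCons.IH[of "Suc n"]] show ?case
    by (simp add: algebra_simps)
qed

lemma flat_has_real_derivative: "(flat j has_real_derivative flat (Suc j) t) (at t)"
proof -
  consider "t < 0" | "t > 0" | "t = 0" by linarith
  then show ?thesis
  proof cases
    case 1
    have "((\<lambda>t. poly (flat_poly j) (inverse t) * exp (inverse t)) has_real_derivative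
        flat (Suc j) t) (at t)"
      using 1 by (auto intro!: derivative_eq_intros DERIV_chain2[OF poly_DERIV]
          simp: flat_def power2_eq_square field_simps)
    then show ?thesis
      by (rule has_field_derivative_transform_within_open[of _ _ _ "{..<0}"]) (use 1 in \<open>auto simp: flat_def\<close>)
  next
    case 2
    have "((\<lambda>t. 0) has_real_derivative flat (Suc j) t) (at t)"
      using 2 by (simp add: flat_def)
    then show ?thesis
      by (rule has_field_derivative_transform_within_open[of _ _ _ "{0<..}"]) (use 2 in \<open>auto simp: flat_def\<close>)
  next
    case 3
    \<comment> \<open>At 0 the formula for t < 0 says nothing about the derivative, so one-sided
      difference quotients are used; dividing by h is the extra factor
      \<open>inverse h\<close>.\<close>
    have "((\<lambda>h. flat j h / h) \<longlongrightarrow> 0) (at_left 0)"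
      by (rule Lim_transform_eventually[OF tendsto_poly_inverse_exp_at_left_0[of 1 "flat_poly j"]])
        (auto simp: eventually_at_filter flat_def field_simps)
    moreover have "((\<lambda>h. flat j h / h) \<longlongrightarrow> 0) (at_right 0)"
      by (rule Lim_transform_eventually[OF tendsto_const])
        (auto simp: eventually_at_filter flat_def)
    ultimately have "((\<lambda>h. flat j h / h) \<longlongrightarrow> 0) (at 0)"
      by (simp add: filterlim_at_split)
    then show ?thesis
      using 3 by (simp add: DERIV_def flat_def)
  qed
qed

lemma continuous_flat: "continuous_on UNIV (flat j)"
  using flat_has_real_derivative by (auto intro!: continuous_at_imp_continuous_on DERIV_isCont)

lemma flat_0_eq: "flat 0 t = (if t < 0 then exp (inverse t) else 0)"
  by (simp add: flat_def)

lemma flat_1_eq: "flat (Suc 0) t = (if t < 0 then - (inverse t)\<^sup>2 * exp (inverse t) else 0)"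
  by (simp add: flat_def power2_eq_square)

lemma flat_0_nonneg: "0 \<le> flat 0 t"
  by (simp add: flat_0_eq)

lemma flat_0_le_1: "flat 0 t \<le> 1"
  by (simp add: flat_0_eq)

lemma flat_1_nonpos: "flat (Suc 0) t \<le> 0"
  by (simp add: flat_1_eq)

text \<open>With s = -1/t > 0 the value has modulus s^2 exp(-s), and exp(s) is at least s^2 /
  2.\<close>

lemma abs_flat_1_le_2: "\<bar>flat (Suc 0) t\<bar> \<le> 2"
proof (cases "t < 0")
  case True
  define s where "s = - inverse t"
  have "s > 0" using True by (simp add: s_def)
  have "s\<^sup>2 / 2 \<le> exp s"
    using exp_lower_Taylor_quadratic[of s] \<open>s > 0\<close> by simp
  then have "s\<^sup>2 * exp (- s) \<le> 2"
    by (simp add: exp_minus field_simps)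
  then show ?thesis
    using True by (simp add: flat_1_eq s_def abs_mult)
qed (simp add: flat_1_eq)

lemma flat_0_lipschitz: "\<bar>flat 0 s - flat 0 t\<bar> \<le> 2 * \<bar>s - t\<bar>"
proof -
  have "norm (flat 0 s - flat 0 t) \<le> 2 * norm (s - t)"
    by (rule field_differentiable_bound[of UNIV "flat 0" "flat (Suc 0)"])
      (auto simp: flat_has_real_derivative abs_flat_1_le_2)
  then show ?thesis by simp
qed

section \<open>Square integrable functions and test functions\<close>

text \<open>Cauchy-Schwarz, by expanding the nonnegative integral of (sqrt B |u| - sqrt A |v|)^2 and
  cancelling sqrt A sqrt B, which forces the separate case of a vanishing norm. The modulus stands
  inside the integral so that the bound survives restriction to a ball in
  \<open>l_op\<close>.\<close>

lemma
  fixes u v :: "'a \<Rightarrow> real"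
  assumes u: "u \<in> borel_measurable M" "integrable M (\<lambda>x. (u x)\<^sup>2)"
    and v: "v \<in> borel_measurable M" "integrable M (\<lambda>x. (v x)\<^sup>2)"
  shows integrable_mult_L2: "integrable M (\<lambda>x. u x * v x)"
    and integral_abs_mult_le_L2:
      "(\<integral>x. \<bar>u x * v x\<bar> \<partial>M) \<le> sqrt (\<integral>x. (u x)\<^sup>2 \<partial>M) * sqrt (\<integral>x. (v x)\<^sup>2 \<partial>M)"
proof -
  note [measurable] = u(1) v(1)
  show int: "integrable M (\<lambda>x. u x * v x)"
  proof (rule Bochner_Integration.integrable_bound)
    show "integrable M (\<lambda>x. (u x)\<^sup>2 + (v x)\<^sup>2)" using u v by auto
    have "\<bar>a * b\<bar> \<le> a\<^sup>2 + b\<^sup>2" for a b :: real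
    proof -
      have "2 * \<bar>a * b\<bar> \<le> a\<^sup>2 + b\<^sup>2"
        using sum_squares_bound[of "\<bar>a\<bar>" "\<bar>b\<bar>"] by (simp add: abs_mult)
      then show ?thesis by linarith
    qed
    then show "AE x in M. norm (u x * v x) \<le> norm ((u x)\<^sup>2 + (v x)\<^sup>2)" by auto
  qed measurable
  define A B where "A = (\<integral>x. (u x)\<^sup>2 \<partial>M)" and "B = (\<integral>x. (v x)\<^sup>2 \<partial>M)"
  have nn: "A \<ge> 0" "B \<ge> 0" by (auto simp: A_def B_def)
  show "(\<integral>x. \<bar>u x * v x\<bar> \<partial>M) \<le> sqrt A * sqrt B"
  proof (cases "A = 0 \<or> B = 0")
    case True
    then have "(AE x in M. (u x)\<^sup>2 = 0) \<or> (AE x in M. (v x)\<^sup>2 = 0)"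
      using integral_nonneg_eq_0_iff_AE[OF u(2)] integral_nonneg_eq_0_iff_AE[OF v(2)]
      by (auto simp: A_def B_def)
    then have "AE x in M. \<bar>u x * v x\<bar> = 0" by auto
    then have "(\<integral>x. \<bar>u x * v x\<bar> \<partial>M) = 0" by (rule integral_eq_zero_AE)
    then show ?thesis using nn by simp
  next
    case False
    then have pos: "sqrt A > 0" "sqrt B > 0" using nn by auto
    have "0 \<le> (\<integral>x. (sqrt B * \<bar>u x\<bar> - sqrt A * \<bar>v x\<bar>)\<^sup>2 \<partial>M)" by simp
    also have "\<dots> = (\<integral>x. B * (u x)\<^sup>2 + A * (v x)\<^sup>2 - 2 * sqrt A * sqrt B * \<bar>u x * v x\<bar> \<partial>M)"
      using nn by (intro Bochner_Integration.integral_cong refl)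
        (simp add: power2_diff power_mult_distrib abs_mult algebra_simps)
    also have "\<dots> = B * A + A * B - 2 * sqrt A * sqrt B * (\<integral>x. \<bar>u x * v x\<bar> \<partial>M)"
      using u v int by (simp add: A_def B_def)
    also have "B * A + A * B = 2 * sqrt A * sqrt B * (sqrt A * sqrt B)"
      using nn by (simp add: algebra_simps)
    finally have "2 * sqrt A * sqrt B * (\<integral>x. \<bar>u x * v x\<bar> \<partial>M) \<le> 2 * sqrt A * sqrt B * (sqrt A * sqrt B)"
      by linarith
    then show ?thesis using pos by simp
  qed
qed

lemma abs_integral_mult_le_L2:
  fixes u v :: "'a \<Rightarrow> real"
  assumes "u \<in> borel_measurable M" "integrable M (\<lambda>x. (u x)\<^sup>2)"
    and "v \<in> borel_measurable M" "integrable M (\<lambda>x. (v x)\<^sup>2)"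
  shows "\<bar>\<integral>x. u x * v x \<partial>M\<bar> \<le> sqrt (\<integral>x. (u x)\<^sup>2 \<partial>M) * sqrt (\<integral>x. (v x)\<^sup>2 \<partial>M)"
  using integral_abs_mult_le_L2[OF assms] integral_abs_bound[of M "\<lambda>x. u x * v x"] by linarith

text \<open>The device for passing to the limit in every identity that is known for test functions
  only.\<close>

lemma tendsto_integral_mult_L2:
  fixes u w :: "'a \<Rightarrow> real"
  assumes w: "w \<in> borel_measurable M" "integrable M (\<lambda>x. (w x)\<^sup>2)"
    and u: "u \<in> borel_measurable M" "integrable M (\<lambda>x. (u x)\<^sup>2)"
    and uk: "\<And>k. uk k \<in> borel_measurable M" "\<And>k. integrable M (\<lambda>x. (uk k x)\<^sup>2)"
    and lim: "(\<lambda>k. \<integral>x. (u x - uk k x)\<^sup>2 \<partial>M) \<longlonglongrightarrow> 0"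
  shows "(\<lambda>k. \<integral>x. w x * uk k x \<partial>M) \<longlonglongrightarrow> (\<integral>x. w x * u x \<partial>M)"
proof -
  have int: "integrable M (\<lambda>x. (u x - uk k x)\<^sup>2)" for k
    using integrable_mult_L2[OF u uk[of k]] u uk[of k] by (auto simp: power2_diff mult.assoc)
  have "norm ((\<integral>x. w x * uk k x \<partial>M) - (\<integral>x. w x * u x \<partial>M))
      \<le> sqrt (\<integral>x. (w x)\<^sup>2 \<partial>M) * sqrt (\<integral>x. (u x - uk k x)\<^sup>2 \<partial>M)" for k
  proof -
    have "(\<integral>x. w x * u x \<partial>M) - (\<integral>x. w x * uk k x \<partial>M) = (\<integral>x. w x * (u x - uk k x) \<partial>M)"
      using integrable_mult_L2[OF w u] integrable_mult_L2[OF w uk[of k]]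
      by (simp add: algebra_simps)
    then show ?thesis
      using abs_integral_mult_le_L2[OF w _ int[of k]] u(1) uk(1)[of k]
      by (simp add: abs_minus_commute)
  qed
  moreover have "(\<lambda>k. sqrt (\<integral>x. (w x)\<^sup>2 \<partial>M) * sqrt (\<integral>x. (u x - uk k x)\<^sup>2 \<partial>M)) \<longlonglongrightarrow> 0"
    using tendsto_mult[OF tendsto_const tendsto_real_sqrt[OF lim]] by simp
  ultimately have "(\<lambda>k. (\<integral>x. w x * uk k x \<partial>M) - (\<integral>x. w x * u x \<partial>M)) \<longlonglongrightarrow> 0"
    by (rule Lim_null_comparison[OF always_eventually[OF allI]])
  then show ?thesis by (rule LIM_zero_cancel)
qed

section \<open>Test functions: supports, bounds, and the integral of a derivative\<close>

lemma test_functionD: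
  assumes "test_function \<Omega> \<phi>"
  shows "continuous_on UNIV \<phi>" "continuous_on UNIV (gradient \<phi>)" "\<phi> differentiable (at x)"
proof -
  have "Ck 0 \<phi>" and C1: "Ck (Suc 0) \<phi>" using assms by (auto simp only: test_function_def)
  then show "continuous_on UNIV \<phi>" "\<phi> differentiable (at x)" by auto
  have "continuous_on UNIV (\<lambda>x. \<Sum>i\<in>Basis. (gradient \<phi> x \<bullet> i) *\<^sub>R i)"
    using C1 by (intro continuous_on_sum continuous_on_scaleR continuous_on_const) simp
  then show "continuous_on UNIV (gradient \<phi>)" by (simp add: euclidean_representation)
qed

text \<open>Off K the function is locally 0, because the complement of a compact set is open; on K
  compactness bounds it together with its gradient.\<close>

lemma test_function_support:
  fixes \<phi> :: "'a::euclidean_space \<Rightarrow> real"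
  assumes "test_function \<Omega> \<phi>"
  obtains K B where "compact K" "K \<subseteq> \<Omega>" "\<And>x. x \<notin> K \<Longrightarrow> \<phi> x = 0" "\<And>x. x \<notin> K \<Longrightarrow> gradient \<phi> x = 0"
    "B \<ge> 0" "\<And>x. \<bar>\<phi> x\<bar> \<le> B" "\<And>x. norm (gradient \<phi> x) \<le> B"
proof -
  from assms obtain K where K: "compact K" "K \<subseteq> \<Omega>" "\<And>x. x \<notin> K \<Longrightarrow> \<phi> x = 0"
    by (auto simp: test_function_def)
  have grad0: "gradient \<phi> x = 0" if "x \<notin> K" for x
  proof -
    have "(\<phi> has_derivative (\<lambda>h. 0)) (at x)"
      by (rule has_derivative_transform_within_open[of "\<lambda>_. 0" _ _ _ "- K"])
        (use K that in \<open>auto simp: compact_imp_closed open_Compl\<close>)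
    from gradient_inner_Basis[OF this] show ?thesis
      by (simp add: euclidean_eq_iff[of "gradient \<phi> x"])
  qed
  have "bounded ((\<lambda>x. \<bar>\<phi> x\<bar> + norm (gradient \<phi> x)) ` K)"
    using test_functionD[OF assms]
    by (intro compact_imp_bounded compact_continuous_image K)
      (auto intro!: continuous_intros intro: continuous_on_subset)
  then obtain B where B: "B > 0" "\<And>x. x \<in> K \<Longrightarrow> \<bar>\<bar>\<phi> x\<bar> + norm (gradient \<phi> x)\<bar> \<le> B"
    by (auto simp: bounded_pos)
  have sum_le: "\<bar>\<phi> x\<bar> + norm (gradient \<phi> x) \<le> B" for x
    using B(1) B(2)[of x] K(3)[of x] grad0[of x] by (cases "x \<in> K") auto
  have "\<bar>\<phi> x\<bar> \<le> B" "norm (gradient \<phi> x) \<le> B" for x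
    using sum_le[of x] norm_ge_zero[of "gradient \<phi> x"] abs_ge_zero[of "\<phi> x"] by linarith+
  with K grad0 B(1) show thesis by (intro that[of K B]) auto
qed

lemma integrable_lborel_compact_support:
  fixes h :: "'a::euclidean_space \<Rightarrow> 'b::euclidean_space"
  assumes "continuous_on UNIV h" "compact K" "\<And>x. x \<notin> K \<Longrightarrow> h x = 0"
  shows "integrable lborel h"
proof -
  have "integrable lborel (\<lambda>x. indicator K x *\<^sub>R h x)"
    by (rule borel_integrable_compact) (use assms in \<open>auto intro: continuous_on_subset\<close>)
  also have "(\<lambda>x. indicator K x *\<^sub>R h x) = h"
    using assms(3) by (auto simp: indicator_def fun_eq_iff)
  finally show ?thesis .
qed

text \<open>The integral of a difference quotient vanishes by translation invariance.\<close>

lemma integral_gradient_test_function: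
  fixes F :: "'a::euclidean_space \<Rightarrow> real"
  assumes F: "test_function UNIV F" and i: "i \<in> Basis"
  shows "(\<integral>x. gradient F x \<bullet> i \<partial>lborel) = 0"
proof -
  obtain K B where K: "compact K" "K \<subseteq> UNIV" "\<And>x. x \<notin> K \<Longrightarrow> F x = 0"
    "\<And>x. x \<notin> K \<Longrightarrow> gradient F x = 0"
    "B \<ge> 0" "\<And>x. \<bar>F x\<bar> \<le> B" "\<And>x. norm (gradient F x) \<le> B"
    by (rule test_function_support[OF F]) (rule that)
  obtain R where R: "K \<subseteq> cball 0 R"
    using bounded_subset_ballD[OF compact_imp_bounded[OF K(1)], of 0] ball_subset_cball by (meson order_trans)
  define h where "h n = inverse (real (Suc n))" for n
  have h: "0 < h n" "h n \<le> 1" for n by (auto simp: h_def field_simps)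
  have h0: "h \<longlonglongrightarrow> 0" unfolding h_def by (rule LIMSEQ_inverse_real_of_nat)
  define q where "q n x = (F (x + h n *\<^sub>R i) - F x) / h n" for n x
  have cont: "continuous_on UNIV F" using test_functionD[OF F] by simp
  note [measurable] = borel_measurable_continuous_onI[OF cont]
    borel_measurable_continuous_onI[OF test_functionD(2)[OF F]]
  have intF: "integrable lborel F"
    by (rule integrable_lborel_compact_support[OF cont K(1,3)])
  have shift: "integrable lborel (\<lambda>x. F (x + c))" "(\<integral>x. F (x + c) \<partial>lborel) = (\<integral>x. F x \<partial>lborel)" for c
  proof -
    have "integrable (distr lborel borel ((+) c)) F" using intF by (simp add: lborel_distr_plus)
    then show "integrable lborel (\<lambda>x. F (x + c))"
      by (subst (asm) integrable_distr_eq) (auto simp: add.commute)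
    have "(\<integral>x. F x \<partial>lborel) = (\<integral>x. F x \<partial>distr lborel borel ((+) c))"
      by (simp add: lborel_distr_plus)
    also have "\<dots> = (\<integral>x. F (x + c) \<partial>lborel)"
      by (subst integral_distr) (auto simp: add.commute)
    finally show "(\<integral>x. F (x + c) \<partial>lborel) = (\<integral>x. F x \<partial>lborel)" by simp
  qed
  have q0: "(\<integral>x. q n x \<partial>lborel) = 0" for n
    using shift[of "h n *\<^sub>R i"] intF by (simp add: q_def)
  have "(\<lambda>n. \<integral>x. q n x \<partial>lborel) \<longlonglongrightarrow> (\<integral>x. gradient F x \<bullet> i \<partial>lborel)"
  proof (rule integral_dominated_convergence[where w = "\<lambda>x. indicator (cball 0 (R + 1)) x * B"])
    show "integrable lborel (\<lambda>x::'a. indicator (cball 0 (R + 1)) x * B)"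
      by (intro integrable_mult_left integrable_real_indicator) (use emeasure_bounded_finite[OF bounded_cball, of "0::'a" "R + 1"] in auto)
    show "q n \<in> borel_measurable lborel" for n unfolding q_def by measurable
    show "AE x in lborel. (\<lambda>n. q n x) \<longlonglongrightarrow> gradient F x \<bullet> i"
    proof (rule AE_I2)
      fix x
      have "((\<lambda>t. F (x + t *\<^sub>R i)) has_derivative (\<lambda>t. gradient F x \<bullet> (t *\<^sub>R i))) (at 0)"
        by (rule has_derivative_compose[where f = "\<lambda>t. x + t *\<^sub>R i" and g = F])
          (use has_derivative_gradient[OF test_functionD(3)[OF F]] in \<open>auto intro!: derivative_eq_intros\<close>)
      then have "((\<lambda>t. F (x + t *\<^sub>R i)) has_real_derivative (gradient F x \<bullet> i)) (at 0)"
        by (simp add: has_field_derivative_def mult_commute_abs)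
      then have "((\<lambda>t. (F (x + t *\<^sub>R i) - F x) / t) \<longlongrightarrow> gradient F x \<bullet> i) (at 0)"
        by (simp add: DERIV_def)
      moreover have "filterlim h (at 0) sequentially"
        using h0 h(1) by (auto simp: filterlim_at less_imp_neq[symmetric] intro!: always_eventually)
      ultimately show "(\<lambda>n. q n x) \<longlonglongrightarrow> gradient F x \<bullet> i"
        unfolding q_def by (rule filterlim_compose)
    qed
    \<comment> \<open>The mean value inequality bounds the quotient by \<open>B\<close>. Steps
      \<open>h n\<close> are at most 1, so all quotients vanish outside the ball of radius
      \<open>R + 1\<close>, which gives an integrable majorant independent of n.\<close>
    show "AE x in lborel. norm (q n x) \<le> indicator (cball 0 (R + 1)) x * B" for n
    proof (rule AE_I2)
      fix x
      have lip: "norm (F (x + h n *\<^sub>R i) - F x) \<le> B * norm (x + h n *\<^sub>R i - x)"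
      proof (rule differentiable_bound[of UNIV])
        show "(F has_derivative (\<lambda>h. gradient F x \<bullet> h)) (at x within UNIV)" for x
          using has_derivative_gradient[OF test_functionD(3)[OF F]] by simp
        show "onorm (\<lambda>h. gradient F x \<bullet> h) \<le> B" for x
          using K(5,7) by (intro onorm_bound) (auto intro!: order_trans[OF Cauchy_Schwarz_ineq2] mult_right_mono)
      qed auto
      show "norm (q n x) \<le> indicator (cball 0 (R + 1)) x * B"
      proof (cases "x \<in> cball 0 (R + 1)")
        case True
        then show ?thesis using lip h(1)[of n] i by (simp add: q_def field_simps)
      next
        case False
        then have "norm x > R + 1" by simp
        moreover have "norm (x + h n *\<^sub>R i) \<ge> norm x - h n"
          using norm_diff_ineq[of x "h n *\<^sub>R i"] i h(1)[of n] by simp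
        ultimately have "x \<notin> K" "x + h n *\<^sub>R i \<notin> K" using R h(2)[of n] by force+
        then show ?thesis using K(3,5) by (simp add: q_def)
      qed
    qed
  qed measurable
  then show ?thesis using q0 by (simp add: LIMSEQ_const_iff)
qed

section \<open>Square integrable functions on a domain\<close>

lemma L2_real: "L2 \<Omega> (u :: _ \<Rightarrow> real) \<longleftrightarrow>
    u \<in> borel_measurable (lebesgue_on \<Omega>) \<and> integrable (lebesgue_on \<Omega>) (\<lambda>x. (u x)\<^sup>2)"
  by (simp add: L2_def)

lemma L2_norm_real: "L2_norm \<Omega> (u :: _ \<Rightarrow> real) = sqrt (\<integral>x. (u x)\<^sup>2 \<partial>lebesgue_on \<Omega>)"
  by (simp add: L2_norm_def)

lemma L2_norm_nonneg: "0 \<le> L2_norm \<Omega> u"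
  by (simp add: L2_norm_def)

lemma L2_norm_square: "(L2_norm \<Omega> u)\<^sup>2 = (\<integral>x. (norm (u x))\<^sup>2 \<partial>lebesgue_on \<Omega>)"
  by (simp add: L2_norm_def)

lemma L2_bound:
  assumes "L2 \<Omega> v" "u \<in> borel_measurable (lebesgue_on \<Omega>)"
    and "\<And>x. x \<in> \<Omega> \<Longrightarrow> norm (u x) \<le> C * norm (v x)"
  shows "L2 \<Omega> u"
  unfolding L2_def
proof
  note [measurable] = assms(2)
  show "integrable (lebesgue_on \<Omega>) (\<lambda>x. (norm (u x))\<^sup>2)"
  proof (rule Bochner_Integration.integrable_bound)
    show "integrable (lebesgue_on \<Omega>) (\<lambda>x. C\<^sup>2 * (norm (v x))\<^sup>2)"
      using assms(1) by (simp add: L2_def)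
    show "AE x in lebesgue_on \<Omega>. norm ((norm (u x))\<^sup>2) \<le> norm (C\<^sup>2 * (norm (v x))\<^sup>2)"
      using assms(3) by (intro AE_I2) (auto simp: power_mult_distrib[symmetric] intro!: power_mono)
  qed measurable
qed (fact assms(2))

lemma L2_norm_bound:
  assumes "L2 \<Omega> v" "u \<in> borel_measurable (lebesgue_on \<Omega>)" "C \<ge> 0"
    and le: "\<And>x. x \<in> \<Omega> \<Longrightarrow> norm (u x) \<le> C * norm (v x)"
  shows "L2_norm \<Omega> u \<le> C * L2_norm \<Omega> v"
proof -
  have "(\<integral>x. (norm (u x))\<^sup>2 \<partial>lebesgue_on \<Omega>) \<le> (\<integral>x. C\<^sup>2 * (norm (v x))\<^sup>2 \<partial>lebesgue_on \<Omega>)"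
  proof (rule integral_mono)
    show "integrable (lebesgue_on \<Omega>) (\<lambda>x. (norm (u x))\<^sup>2)"
      using L2_bound[OF assms(1,2) le] by (simp add: L2_def)
    show "integrable (lebesgue_on \<Omega>) (\<lambda>x. C\<^sup>2 * (norm (v x))\<^sup>2)"
      using assms(1) by (simp add: L2_def)
    show "(norm (u x))\<^sup>2 \<le> C\<^sup>2 * (norm (v x))\<^sup>2" if "x \<in> space (lebesgue_on \<Omega>)" for x
      using le[of x] that by (auto simp: power_mult_distrib[symmetric] intro!: power_mono)
  qed
  then have "L2_norm \<Omega> u \<le> sqrt (C\<^sup>2 * (\<integral>x. (norm (v x))\<^sup>2 \<partial>lebesgue_on \<Omega>))"
    by (simp add: L2_norm_def)
  then show ?thesis using \<open>C \<ge> 0\<close> by (simp add: real_sqrt_mult L2_norm_def)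
qed

lemma norm_diff_square_le: "(norm (a - b))\<^sup>2 \<le> 2 * (norm a)\<^sup>2 + 2 * (norm b)\<^sup>2"
  for a b :: "'a::real_normed_vector"
proof -
  have "(norm (a - b))\<^sup>2 \<le> (norm a + norm b)\<^sup>2"
    by (intro power_mono norm_triangle_ineq4) simp
  also have "\<dots> \<le> 2 * (norm a)\<^sup>2 + 2 * (norm b)\<^sup>2"
    using sum_squares_bound[of "norm a" "norm b"] by (simp add: power2_sum)
  finally show ?thesis .
qed

lemma L2_diff:
  assumes "L2 \<Omega> u" "L2 \<Omega> v"
  shows "L2 \<Omega> (\<lambda>x. u x - v x)"
  unfolding L2_def
proof
  show [measurable]: "(\<lambda>x. u x - v x) \<in> borel_measurable (lebesgue_on \<Omega>)"
    using assms by (auto simp: L2_def)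
  show "integrable (lebesgue_on \<Omega>) (\<lambda>x. (norm (u x - v x))\<^sup>2)"
  proof (rule Bochner_Integration.integrable_bound)
    show "integrable (lebesgue_on \<Omega>) (\<lambda>x. 2 * (norm (u x))\<^sup>2 + 2 * (norm (v x))\<^sup>2)"
      using assms by (simp add: L2_def)
  qed (use norm_diff_square_le in auto)
qed

lemma L2_inner_left: "L2 \<Omega> u \<Longrightarrow> b \<in> Basis \<Longrightarrow> L2 \<Omega> (\<lambda>x. u x \<bullet> b)"
  by (rule L2_bound[where v = u and C = 1]) (auto simp: L2_def Basis_le_norm)

lemma integrable_mult_of_L2:
  assumes "L2 \<Omega> u" "L2 \<Omega> v"
  shows "integrable (lebesgue_on \<Omega>) (\<lambda>x. u x * v x :: real)"
  using assms integrable_mult_L2[of u "lebesgue_on \<Omega>" v] by (simp add: L2_real)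

lemma abs_integral_mult_of_L2:
  assumes "L2 \<Omega> u" "L2 \<Omega> v"
  shows "\<bar>\<integral>x. u x * v x \<partial>lebesgue_on \<Omega>\<bar> \<le> L2_norm \<Omega> u * L2_norm \<Omega> v"
  using assms abs_integral_mult_le_L2[of u "lebesgue_on \<Omega>" v] by (simp add: L2_real L2_norm_real)

lemma tendsto_integral_mult_of_L2:
  fixes u w :: "'a::euclidean_space \<Rightarrow> real"
  assumes "L2 \<Omega> w" "L2 \<Omega> u" "\<And>k. L2 \<Omega> (uk k)"
    and "(\<lambda>k. \<integral>x. (u x - uk k x)\<^sup>2 \<partial>lebesgue_on \<Omega>) \<longlonglongrightarrow> 0"
  shows "(\<lambda>k. \<integral>x. w x * uk k x \<partial>lebesgue_on \<Omega>) \<longlonglongrightarrow> (\<integral>x. w x * u x \<partial>lebesgue_on \<Omega>)"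
  using assms by (intro tendsto_integral_mult_L2) (auto simp: L2_real)

section \<open>Operations on test functions, and their place in \<open>H10\<close>\<close>

lemma test_function_mono: "test_function \<Omega> \<phi> \<Longrightarrow> \<Omega> \<subseteq> \<Omega>' \<Longrightarrow> test_function \<Omega>' \<phi>"
  unfolding test_function_def by (meson subset_trans)

lemma test_function_mult:
  assumes "test_function \<Omega> \<phi>" "\<And>k. Ck k \<psi>"
  shows "test_function \<Omega> (\<lambda>x. \<psi> x * \<phi> x)"
proof -
  obtain K where "compact K" "K \<subseteq> \<Omega>" "\<forall>x. x \<notin> K \<longrightarrow> \<phi> x = 0"
    using assms(1) by (auto simp: test_function_def)
  then show ?thesis
    using assms by (auto simp: test_function_def intro!: Ck_mult exI[of _ K])
qed

lemma gradient_mult: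
  assumes "f differentiable (at x)" "g differentiable (at x)" "i \<in> Basis"
  shows "gradient (\<lambda>x. f x * g x) x \<bullet> i = f x * (gradient g x \<bullet> i) + (gradient f x \<bullet> i) * g x"
  using gradient_inner_Basis[OF has_derivative_mult[OF has_derivative_gradient[OF assms(1)]
        has_derivative_gradient[OF assms(2)]] assms(3)] .

lemma test_function_flat:
  assumes "test_function \<Omega> \<phi>"
  shows "test_function \<Omega> (\<lambda>x. flat 0 (\<phi> x))"
proof -
  obtain K where "compact K" "K \<subseteq> \<Omega>" "\<forall>x. x \<notin> K \<longrightarrow> \<phi> x = 0"
    using assms(1) by (auto simp: test_function_def)
  moreover have "Ck k (\<lambda>x. flat 0 (\<phi> x))" for k
    using assms by (intro Ck_compose[of flat] flat_has_real_derivative) (simp add: test_function_def)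
  ultimately show ?thesis
    by (auto simp: test_function_def flat_0_eq intro!: exI[of _ K])
qed

lemma gradient_flat:
  assumes "f differentiable (at x)"
  shows "gradient (\<lambda>x. flat 0 (f x)) x = flat (Suc 0) (f x) *\<^sub>R gradient f x"
proof -
  have "((\<lambda>x. flat 0 (f x)) has_derivative (\<lambda>h. flat (Suc 0) (f x) * (gradient f x \<bullet> h))) (at x)"
    by (rule has_derivative_compose[OF has_derivative_gradient[OF assms]
          flat_has_real_derivative[unfolded has_field_derivative_def]])
  from gradient_inner_Basis[OF this] show ?thesis
    by (simp add: euclidean_eq_iff[of "gradient (\<lambda>x. flat 0 (f x)) x"])
qed

lemma L2_test_function:
  assumes "\<Omega> \<in> lmeasurable" "test_function \<Omega> \<phi>"
  shows "L2 \<Omega> \<phi>" "L2 \<Omega> (gradient \<phi>)"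
proof -
  obtain K B where K: "compact K" "K \<subseteq> \<Omega>" "\<And>x. x \<notin> K \<Longrightarrow> \<phi> x = 0"
    "\<And>x. x \<notin> K \<Longrightarrow> gradient \<phi> x = 0"
    "B \<ge> 0" "\<And>x. \<bar>\<phi> x\<bar> \<le> B" "\<And>x. norm (gradient \<phi> x) \<le> B"
    by (rule test_function_support[OF assms(2)]) (rule that)
  have meas: "\<phi> \<in> borel_measurable (lebesgue_on \<Omega>)" "gradient \<phi> \<in> borel_measurable (lebesgue_on \<Omega>)"
    using test_functionD[OF assms(2)] assms(1)
    by (auto intro!: continuous_imp_measurable_on_sets_lebesgue intro: continuous_on_subset)
  have "L2 \<Omega> (\<lambda>x. B)"
    using assms(1) finite_measure_lebesgue_on[OF assms(1)]
    by (simp add: L2_def finite_measure.integrable_const)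
  from L2_bound[OF this meas(1), of 1] L2_bound[OF this meas(2), of 1] K
  show "L2 \<Omega> \<phi>" "L2 \<Omega> (gradient \<phi>)" by auto
qed

text \<open>A bridge: the vanishing of integrals of derivatives is proved for \<open>lborel\<close>,
  whereas weak gradients are tested with the completed measure restricted to
  \<open>\<Omega>\<close>.\<close>

lemma integral_lebesgue_on_eq_lborel:
  fixes h :: "'a::euclidean_space \<Rightarrow> real"
  assumes "\<Omega> \<in> sets lebesgue" "continuous_on UNIV h" "\<And>x. x \<notin> \<Omega> \<Longrightarrow> h x = 0"
  shows "(\<integral>x. h x \<partial>lebesgue_on \<Omega>) = (\<integral>x. h x \<partial>lborel)"
proof -
  have "(\<lambda>x. if x \<in> \<Omega> then h x else 0) = h" using assms(3) by auto
  then have "(\<integral>x. h x \<partial>lebesgue_on \<Omega>) = (\<integral>x. h x \<partial>lebesgue)"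
    using Lebesgue_Measure.integral_restrict_UNIV[OF assms(1), of h] by simp
  then show ?thesis
    using borel_measurable_continuous_onI[OF assms(2)] by (simp add: integral_completion)
qed

text \<open>Classical integration by parts: the product with another test function is a test
  function, so its partial derivatives integrate to 0.\<close>

lemma has_weak_gradient_test_function:
  assumes "\<Omega> \<in> sets lebesgue" "test_function \<Omega> w"
  shows "has_weak_gradient \<Omega> w (gradient w)"
  unfolding has_weak_gradient_def
proof (intro allI impI ballI)
  fix \<psi> :: "'a \<Rightarrow> real" and i :: 'a
  assume \<psi>: "test_function \<Omega> \<psi>" and i: "i \<in> Basis"
  note w = test_functionD[OF assms(2)] and p = test_functionD[OF \<psi>]
  obtain K B where K: "compact K" "K \<subseteq> \<Omega>" "\<And>x. x \<notin> K \<Longrightarrow> w x = 0"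
    "\<And>x. x \<notin> K \<Longrightarrow> gradient w x = 0"
    "B \<ge> 0" "\<And>x. \<bar>w x\<bar> \<le> B" "\<And>x. norm (gradient w x) \<le> B"
    by (rule test_function_support[OF assms(2)]) (rule that)
  define a b where "a x = w x * (gradient \<psi> x \<bullet> i)" and "b x = (gradient w x \<bullet> i) * \<psi> x" for x
  have cont: "continuous_on UNIV a" "continuous_on UNIV b"
    unfolding a_def b_def by (intro continuous_intros w p)+
  have int: "integrable lborel a" "integrable lborel b"
    using K by (auto intro!: integrable_lborel_compact_support[OF _ K(1)] cont simp: a_def b_def)
  have out: "a x = 0" "b x = 0" if "x \<notin> \<Omega>" for x
  proof -
    have "x \<notin> K" using K(2) that by blast
    then show "a x = 0" "b x = 0" using K(3,4) by (simp_all add: a_def b_def)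
  qed
  have "test_function UNIV (\<lambda>x. w x * \<psi> x)"
    by (rule test_function_mult)
      (use assms \<psi> in \<open>auto intro: test_function_mono simp: test_function_def\<close>)
  from integral_gradient_test_function[OF this i]
  have "(\<integral>x. a x + b x \<partial>lborel) = 0"
    using gradient_mult[OF w(3) p(3) i] by (simp add: a_def b_def)
  then have "(\<integral>x. a x \<partial>lborel) = - (\<integral>x. b x \<partial>lborel)"
    using int by simp
  then show "(\<integral>x. w x * (gradient \<psi> x \<bullet> i) \<partial>lebesgue_on \<Omega>) =
      - (\<integral>x. (gradient w x \<bullet> i) * \<psi> x \<partial>lebesgue_on \<Omega>)"
    using integral_lebesgue_on_eq_lborel[OF assms(1) cont(1) out(1)]
      integral_lebesgue_on_eq_lborel[OF assms(1) cont(2) out(2)]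
    by (simp add: a_def b_def)
qed

text \<open>Both summands in the defining limit are nonnegative, so each is squeezed to 0. Splitting
  the integral uses their integrability, which holds for test functions because
  \<open>\<Omega>\<close> has finite measure.\<close>

lemma H10_approx:
  assumes "\<Omega> \<in> lmeasurable" "H10 \<Omega> u Du"
  obtains \<phi> where "\<And>k. test_function \<Omega> (\<phi> k)"
    "(\<lambda>k::nat. \<integral>x. (u x - \<phi> k x)\<^sup>2 \<partial>lebesgue_on \<Omega>) \<longlonglongrightarrow> 0"
    "(\<lambda>k. \<integral>x. (norm (Du x - gradient (\<phi> k) x))\<^sup>2 \<partial>lebesgue_on \<Omega>) \<longlonglongrightarrow> 0"
proof -
  obtain \<phi> where \<phi>: "\<And>k. test_function \<Omega> (\<phi> k)"
    and lim: "(\<lambda>k::nat. \<integral>x. (u x - \<phi> k x)\<^sup>2 + (norm (Du x - gradient (\<phi> k) x))\<^sup>2 \<partial>lebesgue_on \<Omega>) \<longlonglongrightarrow> 0"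
    using assms(2) by (auto simp: H10_def)
  have L: "L2 \<Omega> u" "L2 \<Omega> Du" using assms(2) by (auto simp: H10_def)
  have int: "integrable (lebesgue_on \<Omega>) (\<lambda>x. (u x - \<phi> k x)\<^sup>2)"
    "integrable (lebesgue_on \<Omega>) (\<lambda>x. (norm (Du x - gradient (\<phi> k) x))\<^sup>2)" for k
    using L2_diff[OF L(1) L2_test_function(1)[OF assms(1) \<phi>, of k]]
      L2_diff[OF L(2) L2_test_function(2)[OF assms(1) \<phi>, of k]]
    by (auto simp: L2_def)
  have split: "(\<integral>x. (u x - \<phi> k x)\<^sup>2 + (norm (Du x - gradient (\<phi> k) x))\<^sup>2 \<partial>lebesgue_on \<Omega>)
      = (\<integral>x. (u x - \<phi> k x)\<^sup>2 \<partial>lebesgue_on \<Omega>)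
        + (\<integral>x. (norm (Du x - gradient (\<phi> k) x))\<^sup>2 \<partial>lebesgue_on \<Omega>)" for k
    using int by simp
  show thesis
  proof (rule that[OF \<phi>])
    show "(\<lambda>k. \<integral>x. (u x - \<phi> k x)\<^sup>2 \<partial>lebesgue_on \<Omega>) \<longlonglongrightarrow> 0"
      by (rule tendsto_sandwich[OF _ _ tendsto_const lim]) (auto simp: split)
    show "(\<lambda>k. \<integral>x. (norm (Du x - gradient (\<phi> k) x))\<^sup>2 \<partial>lebesgue_on \<Omega>) \<longlonglongrightarrow> 0"
      by (rule tendsto_sandwich[OF _ _ tendsto_const lim]) (auto simp: split)
  qed
qed

lemma tendsto_L2_inner_left:
  assumes "L2 \<Omega> Du" "\<And>k. L2 \<Omega> (D k)" "i \<in> Basis"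
    and "(\<lambda>k. \<integral>x. (norm (Du x - D k x))\<^sup>2 \<partial>lebesgue_on \<Omega>) \<longlonglongrightarrow> 0"
  shows "(\<lambda>k. \<integral>x. (Du x \<bullet> i - D k x \<bullet> i)\<^sup>2 \<partial>lebesgue_on \<Omega>) \<longlonglongrightarrow> 0"
proof (rule tendsto_sandwich[OF _ _ tendsto_const assms(4)])
  have "(\<integral>x. (Du x \<bullet> i - D k x \<bullet> i)\<^sup>2 \<partial>lebesgue_on \<Omega>)
      \<le> (\<integral>x. (norm (Du x - D k x))\<^sup>2 \<partial>lebesgue_on \<Omega>)" for k
  proof (rule integral_mono)
    have L: "L2 \<Omega> (\<lambda>x. Du x - D k x)" using assms by (intro L2_diff)
    then show "integrable (lebesgue_on \<Omega>) (\<lambda>x. (norm (Du x - D k x))\<^sup>2)" by (simp add: L2_def)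
    show "integrable (lebesgue_on \<Omega>) (\<lambda>x. (Du x \<bullet> i - D k x \<bullet> i)\<^sup>2)"
      using L2_inner_left[OF L assms(3)] by (simp add: L2_real inner_diff_left)
    show "(Du x \<bullet> i - D k x \<bullet> i)\<^sup>2 \<le> (norm (Du x - D k x))\<^sup>2" for x
      using Basis_le_norm[OF assms(3), of "Du x - D k x"]
      by (simp add: abs_le_square_iff[symmetric] inner_diff_left)
  qed
  then show "\<forall>\<^sub>F k in sequentially. (\<integral>x. (Du x \<bullet> i - D k x \<bullet> i)\<^sup>2 \<partial>lebesgue_on \<Omega>)
      \<le> (\<integral>x. (norm (Du x - D k x))\<^sup>2 \<partial>lebesgue_on \<Omega>)" by simp
qed simp

text \<open>The weak gradient identity comes for free: it holds for each \<open>w k\<close> and both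
  sides converge, being pairings with the fixed functions \<open>\<psi>\<close> and its partial
  derivatives.\<close>

lemma H10I:
  assumes \<Omega>: "\<Omega> \<in> lmeasurable" and L: "L2 \<Omega> u" "L2 \<Omega> Du"
    and w: "\<And>k. test_function \<Omega> (w k)"
    and lim: "(\<lambda>k::nat. \<integral>x. (u x - w k x)\<^sup>2 \<partial>lebesgue_on \<Omega>) \<longlonglongrightarrow> 0"
    "(\<lambda>k. \<integral>x. (norm (Du x - gradient (w k) x))\<^sup>2 \<partial>lebesgue_on \<Omega>) \<longlonglongrightarrow> 0"
  shows "H10 \<Omega> u Du"
  unfolding H10_def
proof (intro conjI exI[of _ w] allI)
  note Lw = L2_test_function[OF \<Omega> w]
  show "has_weak_gradient \<Omega> u Du"
    unfolding has_weak_gradient_def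
  proof (intro allI impI ballI)
    fix \<psi> :: "'a \<Rightarrow> real" and i :: 'a
    assume \<psi>: "test_function \<Omega> \<psi>" and i: "i \<in> Basis"
    note L\<psi> = L2_test_function[OF \<Omega> \<psi>]
    have "(\<integral>x. (gradient \<psi> x \<bullet> i) * w k x \<partial>lebesgue_on \<Omega>) =
        - (\<integral>x. \<psi> x * (gradient (w k) x \<bullet> i) \<partial>lebesgue_on \<Omega>)" for k
      using has_weak_gradient_test_function[OF fmeasurableD[OF \<Omega>] w[of k]] \<psi> i
      by (simp add: has_weak_gradient_def mult.commute)
    moreover have "(\<lambda>k. \<integral>x. (gradient \<psi> x \<bullet> i) * w k x \<partial>lebesgue_on \<Omega>)
        \<longlonglongrightarrow> (\<integral>x. (gradient \<psi> x \<bullet> i) * u x \<partial>lebesgue_on \<Omega>)"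
      by (intro tendsto_integral_mult_of_L2 L2_inner_left L\<psi> i Lw L lim)
    moreover have "(\<lambda>k. \<integral>x. \<psi> x * (gradient (w k) x \<bullet> i) \<partial>lebesgue_on \<Omega>)
        \<longlonglongrightarrow> (\<integral>x. \<psi> x * (Du x \<bullet> i) \<partial>lebesgue_on \<Omega>)"
      by (intro tendsto_integral_mult_of_L2 L2_inner_left tendsto_L2_inner_left L\<psi> i Lw L lim)
    ultimately have "(\<integral>x. (gradient \<psi> x \<bullet> i) * u x \<partial>lebesgue_on \<Omega>) =
        - (\<integral>x. \<psi> x * (Du x \<bullet> i) \<partial>lebesgue_on \<Omega>)"
      by (metis (no_types, lifting) LIMSEQ_unique tendsto_cong tendsto_minus ext)
    then show "(\<integral>x. u x * (gradient \<psi> x \<bullet> i) \<partial>lebesgue_on \<Omega>) =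
        - (\<integral>x. (Du x \<bullet> i) * \<psi> x \<partial>lebesgue_on \<Omega>)"
      by (simp add: mult.commute)
  qed
  have "integrable (lebesgue_on \<Omega>) (\<lambda>x. (u x - w k x)\<^sup>2)"
    "integrable (lebesgue_on \<Omega>) (\<lambda>x. (norm (Du x - gradient (w k) x))\<^sup>2)" for k
    using L2_diff[OF L(1) Lw(1)[of k]] L2_diff[OF L(2) Lw(2)[of k]] by (auto simp: L2_def)
  then show "(\<lambda>k. \<integral>x. (u x - w k x)\<^sup>2 + (norm (Du x - gradient (w k) x))\<^sup>2 \<partial>lebesgue_on \<Omega>) \<longlonglongrightarrow> 0"
    using tendsto_add[OF lim] by simp
qed (use L w in auto)

section \<open>Poincare inequality and maximum principle\<close>

text \<open>Testing the weak gradient of \<open>u\<close> against $x_i \phi_k$ with $\phi_k \to u$ gives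
  $\int u^2 = -2 \int x_i u\, \partial_i u$.\<close>

lemma Poincare_H10:
  assumes \<Omega>: "\<Omega> \<in> lmeasurable" "\<Omega> \<subseteq> cball 0 R" and u: "H10 \<Omega> u Du"
  shows "L2_norm \<Omega> u \<le> 2 * R * L2_norm \<Omega> Du"
proof (cases "\<Omega> = {}")
  case True
  then show ?thesis by (simp add: L2_norm_def)
next
  case False
  then have R: "R \<ge> 0" using \<Omega>(2) by force
  obtain i :: 'a where i: "i \<in> Basis" using nonempty_Basis by blast
  have L: "L2 \<Omega> u" "L2 \<Omega> Du" and wk: "has_weak_gradient \<Omega> u Du"
    using u by (auto simp: H10_def)
  obtain \<phi> where \<phi>: "\<And>k::nat. test_function \<Omega> (\<phi> k)"
    and lim: "(\<lambda>k. \<integral>x. (u x - \<phi> k x)\<^sup>2 \<partial>lebesgue_on \<Omega>) \<longlonglongrightarrow> 0"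
    "(\<lambda>k. \<integral>x. (norm (Du x - gradient (\<phi> k) x))\<^sup>2 \<partial>lebesgue_on \<Omega>) \<longlonglongrightarrow> 0"
    by (rule H10_approx[OF \<Omega>(1) u]) (rule that)
  note L\<phi> = L2_test_function[OF \<Omega>(1) \<phi>]
  have coord: "(\<lambda>x. x \<bullet> i) \<in> borel_measurable (lebesgue_on \<Omega>)"
    using \<Omega>(1) by (intro continuous_imp_measurable_on_sets_lebesgue continuous_intros) auto
  have coord_le: "\<bar>x \<bullet> i\<bar> \<le> R" if "x \<in> \<Omega>" for x
    using that \<Omega>(2) Basis_le_norm[OF i, of x] by force
  \<comment> \<open>The coordinate is bounded by \<open>R\<close> on \<open>\<Omega>\<close>, so
    both products are square integrable, and every term of the identity becomes a fixed function
    paired with \<open>\<phi> k\<close> or a partial derivative of it.\<close>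
  define p q where "p x = u x * (x \<bullet> i)" and "q x = (Du x \<bullet> i) * (x \<bullet> i)" for x
  have meas: "p \<in> borel_measurable (lebesgue_on \<Omega>)" "q \<in> borel_measurable (lebesgue_on \<Omega>)"
    unfolding p_def q_def using coord L L2_inner_left[OF L(2) i] by (auto simp: L2_def)
  have p_le: "norm (p x) \<le> R * norm (u x)" if "x \<in> \<Omega>" for x
    using mult_left_mono[OF coord_le[OF that], of "\<bar>u x\<bar>"] by (simp add: p_def abs_mult mult.commute)
  have q_le: "norm (q x) \<le> R * norm (Du x)" if "x \<in> \<Omega>" for x
    using mult_mono[OF Basis_le_norm[OF i, of "Du x"] coord_le[OF that]] by (simp add: q_def abs_mult mult.commute)
  have Lp: "L2 \<Omega> p" by (rule L2_bound[OF L(1) meas(1) p_le])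
  have Lq: "L2 \<Omega> q" by (rule L2_bound[OF L(2) meas(2) q_le])
  have Dui: "L2 \<Omega> (\<lambda>x. Du x \<bullet> i)" by (rule L2_inner_left[OF L(2) i])
  have eq: "(\<integral>x. u x * \<phi> k x \<partial>lebesgue_on \<Omega>) + (\<integral>x. p x * (gradient (\<phi> k) x \<bullet> i) \<partial>lebesgue_on \<Omega>)
      = - (\<integral>x. q x * \<phi> k x \<partial>lebesgue_on \<Omega>)" for k
  proof -
    have "test_function \<Omega> (\<lambda>x. (x \<bullet> i) * \<phi> k x)"
      by (rule test_function_mult[OF \<phi> Ck_inner_left])
    then have "(\<integral>x. u x * (gradient (\<lambda>x. (x \<bullet> i) * \<phi> k x) x \<bullet> i) \<partial>lebesgue_on \<Omega>) =
        - (\<integral>x. (Du x \<bullet> i) * ((x \<bullet> i) * \<phi> k x) \<partial>lebesgue_on \<Omega>)"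
      using wk i by (simp add: has_weak_gradient_def)
    moreover have "gradient (\<lambda>x. (x \<bullet> i) * \<phi> k x) x \<bullet> i = (x \<bullet> i) * (gradient (\<phi> k) x \<bullet> i) + \<phi> k x" for x
    proof -
      have d: "((\<lambda>x. x \<bullet> i) has_derivative (\<lambda>h. h \<bullet> i)) (at x)" by (auto intro!: derivative_eq_intros)
      have "gradient (\<lambda>x. (x \<bullet> i) * \<phi> k x) x \<bullet> i
          = (x \<bullet> i) * (gradient (\<phi> k) x \<bullet> i) + (gradient (\<lambda>x. x \<bullet> i) x \<bullet> i) * \<phi> k x"
        using d by (intro gradient_mult[OF _ test_functionD(3)[OF \<phi>] i]) (auto simp: differentiable_def)
      then show ?thesis using gradient_inner_Basis[OF d i] i by simp
    qed
    ultimately have "(\<integral>x. u x * \<phi> k x + p x * (gradient (\<phi> k) x \<bullet> i) \<partial>lebesgue_on \<Omega>) =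
        - (\<integral>x. q x * \<phi> k x \<partial>lebesgue_on \<Omega>)"
      by (simp add: p_def q_def algebra_simps)
    then show ?thesis
      using integrable_mult_of_L2[OF L(1) L\<phi>(1)[of k]]
        integrable_mult_of_L2[OF Lp L2_inner_left[OF L\<phi>(2)[of k] i]] by simp
  qed
  have "(\<lambda>k. (\<integral>x. u x * \<phi> k x \<partial>lebesgue_on \<Omega>) + (\<integral>x. p x * (gradient (\<phi> k) x \<bullet> i) \<partial>lebesgue_on \<Omega>))
      \<longlonglongrightarrow> (\<integral>x. u x * u x \<partial>lebesgue_on \<Omega>) + (\<integral>x. p x * (Du x \<bullet> i) \<partial>lebesgue_on \<Omega>)"
    by (intro tendsto_add tendsto_integral_mult_of_L2 tendsto_L2_inner_left L2_inner_left L Lp L\<phi> i lim)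
  moreover have "(\<lambda>k. - (\<integral>x. q x * \<phi> k x \<partial>lebesgue_on \<Omega>)) \<longlonglongrightarrow> - (\<integral>x. q x * u x \<partial>lebesgue_on \<Omega>)"
    by (intro tendsto_minus tendsto_integral_mult_of_L2 L Lq L\<phi> lim)
  ultimately have "(\<integral>x. u x * u x \<partial>lebesgue_on \<Omega>) + (\<integral>x. p x * (Du x \<bullet> i) \<partial>lebesgue_on \<Omega>)
      = - (\<integral>x. q x * u x \<partial>lebesgue_on \<Omega>)"
    unfolding eq by (rule LIMSEQ_unique)
  \<comment> \<open>Both limits are the same integral of x_i u times the i-th derivative of u; this
    is the source of the factor 2.\<close>
  moreover have "(\<integral>x. p x * (Du x \<bullet> i) \<partial>lebesgue_on \<Omega>) = (\<integral>x. q x * u x \<partial>lebesgue_on \<Omega>)"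
    by (simp add: p_def q_def mult_ac)
  ultimately have "(L2_norm \<Omega> u)\<^sup>2 = - 2 * (\<integral>x. q x * u x \<partial>lebesgue_on \<Omega>)"
    unfolding L2_norm_square by (simp add: power2_eq_square)
  also have "\<dots> \<le> 2 * (L2_norm \<Omega> q * L2_norm \<Omega> u)"
    using abs_integral_mult_of_L2[OF Lq L(1)] by linarith
  also have "L2_norm \<Omega> q * L2_norm \<Omega> u \<le> R * L2_norm \<Omega> Du * L2_norm \<Omega> u"
    by (intro mult_right_mono L2_norm_bound[OF L(2) meas(2) R q_le] L2_norm_nonneg)
  finally have "L2_norm \<Omega> u * L2_norm \<Omega> u \<le> (2 * R * L2_norm \<Omega> Du) * L2_norm \<Omega> u"
    by (simp add: power2_eq_square)
  then show ?thesis
    using R L2_norm_nonneg[of \<Omega> u] L2_norm_nonneg[of \<Omega> Du]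
    by (cases "L2_norm \<Omega> u = 0") auto
qed

text \<open>Chain rule by approximation with \<open>flat 0\<close> of test functions. The functions
  converge by the Lipschitz bound. The gradient error splits into flat'(phi_k) times the error of
  the gradients, and (flat'(u) - flat'(phi_k)) Du, which needs almost everywhere
  convergence.\<close>

lemma H10_flat:
  assumes \<Omega>: "\<Omega> \<in> lmeasurable" and u: "H10 \<Omega> u Du"
  shows "H10 \<Omega> (\<lambda>x. flat 0 (u x)) (\<lambda>x. flat (Suc 0) (u x) *\<^sub>R Du x)"
proof -
  have L: "L2 \<Omega> u" "L2 \<Omega> Du" using u by (auto simp: H10_def)
  note [measurable] = borel_measurable_continuous_onI[OF continuous_flat]
  have [measurable]: "u \<in> borel_measurable (lebesgue_on \<Omega>)" "Du \<in> borel_measurable (lebesgue_on \<Omega>)"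
    using L by (auto simp: L2_def)
  obtain \<phi>0 where \<phi>0: "\<And>k::nat. test_function \<Omega> (\<phi>0 k)"
    and lim0: "(\<lambda>k. \<integral>x. (u x - \<phi>0 k x)\<^sup>2 \<partial>lebesgue_on \<Omega>) \<longlonglongrightarrow> 0"
    "(\<lambda>k. \<integral>x. (norm (Du x - gradient (\<phi>0 k) x))\<^sup>2 \<partial>lebesgue_on \<Omega>) \<longlonglongrightarrow> 0"
    by (rule H10_approx[OF \<Omega> u]) (rule that)
  \<comment> \<open>Convergence in L2 gives pointwise convergence only along a subsequence; the
    approximating sequence is then replaced by it.\<close>
  have "\<exists>r::nat\<Rightarrow>nat. strict_mono r \<and>
      (AE x in lebesgue_on \<Omega>. (\<lambda>k. (u x - \<phi>0 (r k) x)\<^sup>2) \<longlonglongrightarrow> 0)"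
    using lim0(1) L2_diff[OF L(1) L2_test_function(1)[OF \<Omega> \<phi>0]]
    by (intro tendsto_L1_AE_subseq) (auto simp: L2_real)
  then obtain r :: "nat \<Rightarrow> nat" where r: "strict_mono r"
    and ae0: "AE x in lebesgue_on \<Omega>. (\<lambda>k. (u x - \<phi>0 (r k) x)\<^sup>2) \<longlonglongrightarrow> 0" by blast
  define \<phi> where "\<phi> k = \<phi>0 (r k)" for k
  have \<phi>: "test_function \<Omega> (\<phi> k)" for k using \<phi>0 by (simp add: \<phi>_def)
  have lim: "(\<lambda>k. \<integral>x. (u x - \<phi> k x)\<^sup>2 \<partial>lebesgue_on \<Omega>) \<longlonglongrightarrow> 0"
    "(\<lambda>k. \<integral>x. (norm (Du x - gradient (\<phi> k) x))\<^sup>2 \<partial>lebesgue_on \<Omega>) \<longlonglongrightarrow> 0"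
    using lim0[THEN LIMSEQ_subseq_LIMSEQ[OF _ r]] by (simp_all add: \<phi>_def o_def)
  have ae: "AE x in lebesgue_on \<Omega>. (\<lambda>k. \<phi> k x) \<longlonglongrightarrow> u x"
    using ae0
  proof eventually_elim
    case (elim x)
    then have "(\<lambda>k. sqrt ((u x - \<phi> k x)\<^sup>2)) \<longlonglongrightarrow> sqrt 0"
      unfolding \<phi>_def by (rule tendsto_real_sqrt)
    then have "(\<lambda>k. \<phi> k x - u x) \<longlonglongrightarrow> 0"
      by (subst tendsto_rabs_zero_iff[symmetric]) (simp add: abs_minus_commute)
    then show ?case by (rule LIM_zero_cancel)
  qed
  note L\<phi> = L2_test_function[OF \<Omega> \<phi>]
  have [measurable]: "\<phi> k \<in> borel_measurable (lebesgue_on \<Omega>)"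
      "gradient (\<phi> k) \<in> borel_measurable (lebesgue_on \<Omega>)" for k
    using L\<phi>[of k] by (auto simp: L2_def)
  have Ld: "L2 \<Omega> (\<lambda>x. u x - \<phi> k x)" "L2 \<Omega> (\<lambda>x. Du x - gradient (\<phi> k) x)" for k
    by (intro L2_diff L L\<phi>)+
  define v Dv where "v x = flat 0 (u x)" and "Dv x = flat (Suc 0) (u x) *\<^sub>R Du x" for x
  have v_meas: "v \<in> borel_measurable (lebesgue_on \<Omega>)" unfolding v_def[abs_def] by measurable
  have Dv_meas: "Dv \<in> borel_measurable (lebesgue_on \<Omega>)" unfolding Dv_def[abs_def] by measurable
  define w where "w k x = flat 0 (\<phi> k x)" for k x
  have w: "test_function \<Omega> (w k)" for k unfolding w_def[abs_def] by (rule test_function_flat[OF \<phi>])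
  have grad_w: "gradient (w k) x = flat (Suc 0) (\<phi> k x) *\<^sub>R gradient (\<phi> k) x" for k x
    unfolding w_def[abs_def] by (rule gradient_flat[OF test_functionD(3)[OF \<phi>]])
  note Lw = L2_test_function[OF \<Omega> w]
  have Lv: "L2 \<Omega> v"
  proof (rule L2_bound)
    show "L2 \<Omega> (\<lambda>_. 1 :: real)"
      using \<Omega> finite_measure_lebesgue_on[OF \<Omega>] by (simp add: L2_def finite_measure.integrable_const)
    show "norm (v x) \<le> 1 * norm (1 :: real)" for x
      using flat_0_le_1[of "u x"] flat_0_nonneg[of "u x"] by (simp add: v_def)
  qed (fact v_meas)
  have LDv: "L2 \<Omega> Dv"
    by (rule L2_bound[OF L(2) Dv_meas, where C = 2])
      (use abs_flat_1_le_2 in \<open>auto simp: Dv_def intro!: mult_right_mono\<close>)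
  have "H10 \<Omega> v Dv"
  proof (rule H10I[OF \<Omega> Lv LDv w])
    have v_le: "(\<integral>x. (v x - w k x)\<^sup>2 \<partial>lebesgue_on \<Omega>) \<le> (\<integral>x. 4 * (u x - \<phi> k x)\<^sup>2 \<partial>lebesgue_on \<Omega>)" for k
    proof (rule integral_mono)
      show "integrable (lebesgue_on \<Omega>) (\<lambda>x. (v x - w k x)\<^sup>2)"
        using L2_diff[OF Lv Lw(1)] by (simp add: L2_real)
      show "integrable (lebesgue_on \<Omega>) (\<lambda>x. 4 * (u x - \<phi> k x)\<^sup>2)"
        using Ld(1) by (simp add: L2_real)
      have "\<bar>v x - w k x\<bar>\<^sup>2 \<le> (2 * \<bar>u x - \<phi> k x\<bar>)\<^sup>2" for x
        unfolding v_def w_def by (intro power_mono flat_0_lipschitz) simp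
      then show "(v x - w k x)\<^sup>2 \<le> 4 * (u x - \<phi> k x)\<^sup>2" for x
        by (simp add: power_mult_distrib)
    qed
    have lim4: "(\<lambda>k. \<integral>x. 4 * (u x - \<phi> k x)\<^sup>2 \<partial>lebesgue_on \<Omega>) \<longlonglongrightarrow> 0"
      using tendsto_mult_left[OF lim(1), of 4] by simp
    show "(\<lambda>k. \<integral>x. (v x - w k x)\<^sup>2 \<partial>lebesgue_on \<Omega>) \<longlonglongrightarrow> 0"
      by (rule tendsto_sandwich[OF _ _ tendsto_const lim4]) (use v_le in auto)
    \<comment> \<open>The part of the gradient error in which only the coefficient of
      \<open>Du\<close> changes. Both coefficients are at most 2 in modulus, hence the majorant with
      16 = (2 + 2)^2.\<close>
    define e where "e k x = ((flat (Suc 0) (u x) - flat (Suc 0) (\<phi> k x)) * norm (Du x))\<^sup>2" for k x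
    have e_le: "e k x \<le> 16 * (norm (Du x))\<^sup>2" for k x
    proof -
      have "\<bar>flat (Suc 0) (u x) - flat (Suc 0) (\<phi> k x)\<bar> \<le> 4"
        using abs_flat_1_le_2[of "u x"] abs_flat_1_le_2[of "\<phi> k x"] by linarith
      then have "\<bar>flat (Suc 0) (u x) - flat (Suc 0) (\<phi> k x)\<bar>\<^sup>2 \<le> 4\<^sup>2" by (intro power_mono) auto
      then show ?thesis by (auto simp: e_def power_mult_distrib intro!: mult_right_mono)
    qed
    have e_meas [measurable]: "e k \<in> borel_measurable (lebesgue_on \<Omega>)" for k
      unfolding e_def[abs_def] by measurable
    have int_Du: "integrable (lebesgue_on \<Omega>) (\<lambda>x. 16 * (norm (Du x))\<^sup>2)"
      using L(2) by (simp add: L2_def)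
    have e_int: "integrable (lebesgue_on \<Omega>) (e k)" for k
      by (rule Bochner_Integration.integrable_bound[OF int_Du e_meas])
        (use e_le in \<open>auto simp: e_def\<close>)
    have "(\<lambda>k. \<integral>x. e k x \<partial>lebesgue_on \<Omega>) \<longlonglongrightarrow> (\<integral>x. 0 \<partial>lebesgue_on \<Omega>)"
    proof (rule integral_dominated_convergence[OF _ _ int_Du])
      show "AE x in lebesgue_on \<Omega>. (\<lambda>k. e k x) \<longlonglongrightarrow> 0"
        using ae
      proof eventually_elim
        case (elim x)
        have "(\<lambda>k. flat (Suc 0) (\<phi> k x)) \<longlonglongrightarrow> flat (Suc 0) (u x)"
          by (rule isCont_tendsto_compose[OF _ elim]) (use continuous_flat in \<open>auto simp: continuous_on_eq_continuous_at\<close>)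
        then have "(\<lambda>k. e k x) \<longlonglongrightarrow> ((flat (Suc 0) (u x) - flat (Suc 0) (u x)) * norm (Du x))\<^sup>2"
          unfolding e_def by (intro tendsto_intros)
        then show ?case by simp
      qed
      show "AE x in lebesgue_on \<Omega>. norm (e k x) \<le> 16 * (norm (Du x))\<^sup>2" for k
        using e_le[of k] by (auto simp: e_def)
    qed auto
    then have e_lim: "(\<lambda>k. \<integral>x. e k x \<partial>lebesgue_on \<Omega>) \<longlonglongrightarrow> 0" by simp
    have Dv_le: "(\<integral>x. (norm (Dv x - gradient (w k) x))\<^sup>2 \<partial>lebesgue_on \<Omega>)
        \<le> (\<integral>x. 8 * (norm (Du x - gradient (\<phi> k) x))\<^sup>2 + 2 * e k x \<partial>lebesgue_on \<Omega>)" for k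
    proof (rule integral_mono)
      show "integrable (lebesgue_on \<Omega>) (\<lambda>x. (norm (Dv x - gradient (w k) x))\<^sup>2)"
        using L2_diff[OF LDv Lw(2)] by (simp add: L2_def)
      show "integrable (lebesgue_on \<Omega>) (\<lambda>x. 8 * (norm (Du x - gradient (\<phi> k) x))\<^sup>2 + 2 * e k x)"
        using Ld(2)[of k] e_int[of k] by (simp add: L2_def)
      fix x
      define s where "s = flat (Suc 0) (\<phi> k x) *\<^sub>R (Du x - gradient (\<phi> k) x)"
      \<comment> \<open>The minus sign matches \<open>norm_diff_square_le\<close>, which is stated
        for a difference.\<close>
      define t where "t = - ((flat (Suc 0) (u x) - flat (Suc 0) (\<phi> k x)) *\<^sub>R Du x)"
      have "Dv x - gradient (w k) x = s - t"
        by (simp add: Dv_def grad_w s_def t_def algebra_simps)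
      then have "(norm (Dv x - gradient (w k) x))\<^sup>2 \<le> 2 * (norm s)\<^sup>2 + 2 * (norm t)\<^sup>2"
        using norm_diff_square_le[of s t] by simp
      moreover have "(norm t)\<^sup>2 = e k x"
        by (simp add: t_def e_def power_mult_distrib)
      moreover have "(norm s)\<^sup>2 \<le> 4 * (norm (Du x - gradient (\<phi> k) x))\<^sup>2"
      proof -
        have "(norm s)\<^sup>2 \<le> (2 * norm (Du x - gradient (\<phi> k) x))\<^sup>2"
          unfolding s_def norm_scaleR using abs_flat_1_le_2 by (intro power_mono mult_right_mono) auto
        then show ?thesis by (simp add: power_mult_distrib)
      qed
      ultimately show "(norm (Dv x - gradient (w k) x))\<^sup>2
          \<le> 8 * (norm (Du x - gradient (\<phi> k) x))\<^sup>2 + 2 * e k x" by linarith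
    qed
    have split8: "(\<integral>x. 8 * (norm (Du x - gradient (\<phi> k) x))\<^sup>2 + 2 * e k x \<partial>lebesgue_on \<Omega>)
        = 8 * (\<integral>x. (norm (Du x - gradient (\<phi> k) x))\<^sup>2 \<partial>lebesgue_on \<Omega>) + 2 * (\<integral>x. e k x \<partial>lebesgue_on \<Omega>)" for k
      using Ld(2)[of k] e_int[of k] by (simp add: L2_def)
    have lim8: "(\<lambda>k. 8 * (\<integral>x. (norm (Du x - gradient (\<phi> k) x))\<^sup>2 \<partial>lebesgue_on \<Omega>)
        + 2 * (\<integral>x. e k x \<partial>lebesgue_on \<Omega>)) \<longlonglongrightarrow> 0"
      using tendsto_add[OF tendsto_mult_left[OF lim(2), of 8] tendsto_mult_left[OF e_lim, of 2]] by simp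
    show "(\<lambda>k. \<integral>x. (norm (Dv x - gradient (w k) x))\<^sup>2 \<partial>lebesgue_on \<Omega>) \<longlonglongrightarrow> 0"
      by (rule tendsto_sandwich[OF _ _ tendsto_const lim8]) (use Dv_le split8 in auto)
  qed
  then show ?thesis by (simp add: v_def[abs_def] Dv_def[abs_def])
qed

text \<open>With v = flat(u) as test function, the right side is nonnegative while the left side is
  c times the integral of flat'(u) |Du|^2, which is nonpositive. So the integrand vanishes, the
  gradient of v is 0, and the Poincare inequality gives v = 0, that is, u is nowhere negative up to
  a null set.\<close>

lemma weak_solution_nonneg:
  assumes \<Omega>: "\<Omega> \<in> lmeasurable" "bounded \<Omega>" and u: "weak_solution \<Omega> (\<lambda>_. c) f u Du" and c: "c > 0"
    and f: "AE x in lebesgue_on \<Omega>. f x \<ge> 0"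
  shows "AE x in lebesgue_on \<Omega>. u x \<ge> 0"
proof -
  have H: "H10 \<Omega> u Du" using u by (simp add: weak_solution_def)
  then have L: "L2 \<Omega> u" "L2 \<Omega> Du" by (auto simp: H10_def)
  define v Dv where "v x = flat 0 (u x)" and "Dv x = flat (Suc 0) (u x) *\<^sub>R Du x" for x
  have v: "H10 \<Omega> v Dv" unfolding v_def[abs_def] Dv_def[abs_def] by (rule H10_flat[OF \<Omega>(1) H])
  then have Lv: "L2 \<Omega> v" "L2 \<Omega> Dv" by (auto simp: H10_def)
  have "(\<integral>x. c * (Du x \<bullet> Dv x) \<partial>lebesgue_on \<Omega>) = (\<integral>x. f x * v x \<partial>lebesgue_on \<Omega>)"
    using u v by (simp add: weak_solution_def)
  also have "\<dots> \<ge> 0"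
    by (rule integral_nonneg_AE) (use f in eventually_elim, auto simp: v_def flat_0_nonneg)
  finally have le: "(\<integral>x. - (Du x \<bullet> Dv x) \<partial>lebesgue_on \<Omega>) \<le> 0"
    using c by (simp add: zero_le_mult_iff)
  have nn: "0 \<le> - (Du x \<bullet> Dv x)" for x
    using flat_1_nonpos[of "u x"] by (simp add: Dv_def mult_nonpos_nonneg)
  have int: "integrable (lebesgue_on \<Omega>) (\<lambda>x. - (Du x \<bullet> Dv x))"
  proof (rule Bochner_Integration.integrable_bound)
    show "integrable (lebesgue_on \<Omega>) (\<lambda>x. 2 * (norm (Du x))\<^sup>2)" using L by (simp add: L2_def)
    show "(\<lambda>x. - (Du x \<bullet> Dv x)) \<in> borel_measurable (lebesgue_on \<Omega>)"
      using L Lv by (auto simp: L2_def)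
    have "\<bar>Du x \<bullet> Dv x\<bar> \<le> 2 * (norm (Du x))\<^sup>2" for x
      using abs_flat_1_le_2[of "u x"]
      by (auto simp: Dv_def abs_mult power2_norm_eq_inner intro!: mult_right_mono)
    then show "AE x in lebesgue_on \<Omega>. norm (- (Du x \<bullet> Dv x)) \<le> norm (2 * (norm (Du x))\<^sup>2)" by simp
  qed
  have "(\<integral>x. - (Du x \<bullet> Dv x) \<partial>lebesgue_on \<Omega>) = 0"
    using le nn by (intro antisym integral_nonneg_AE) auto
  then have "AE x in lebesgue_on \<Omega>. - (Du x \<bullet> Dv x) = 0"
    using integral_nonneg_eq_0_iff_AE[OF int] nn by auto
  \<comment> \<open>A vanishing product flat'(u) |Du|^2 means that one factor is 0, and either way
    \<open>Dv x\<close> is 0.\<close>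
  then have "AE x in lebesgue_on \<Omega>. (norm (Dv x))\<^sup>2 = 0"
    by eventually_elim (auto simp: Dv_def)
  then have "(L2_norm \<Omega> Dv)\<^sup>2 = 0"
    unfolding L2_norm_square by (rule integral_eq_zero_AE)
  then have Dv0: "L2_norm \<Omega> Dv = 0" by simp
  obtain R where R: "\<Omega> \<subseteq> cball 0 R"
    using bounded_subset_ballD[OF \<Omega>(2), of 0] ball_subset_cball by (meson order_trans)
  have "L2_norm \<Omega> v \<le> 0"
    using Poincare_H10[OF \<Omega>(1) R v] Dv0 by simp
  then have "(\<integral>x. (v x)\<^sup>2 \<partial>lebesgue_on \<Omega>) = 0"
    by (simp add: L2_norm_real order_antisym)
  then have "AE x in lebesgue_on \<Omega>. (v x)\<^sup>2 = 0"
    using integral_nonneg_eq_0_iff_AE[of "lebesgue_on \<Omega>" "\<lambda>x. (v x)\<^sup>2"] Lv(1) by (simp add: L2_real)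
  then show ?thesis
    by eventually_elim (auto simp: v_def flat_0_eq split: if_splits)
qed

section \<open>Pointwise bound on the derivative of the coefficient\<close>

text \<open>One factor is positive exactly for t < 1, the other exactly for t > -1. The integral is
  not normalised to 1; it cancels at the end of the averaging argument, so its positivity
  suffices.\<close>

definition bump :: "real \<Rightarrow> real" where
  "bump t = flat 0 (t - 1) * flat 0 (- t - 1)"

lemma bump_nonneg: "0 \<le> bump t"
  by (simp add: bump_def flat_0_nonneg)

lemma bump_eq_0: "1 \<le> \<bar>t\<bar> \<Longrightarrow> bump t = 0"
  by (auto simp: bump_def flat_0_eq)

lemma bump_pos: "\<bar>t\<bar> < 1 \<Longrightarrow> 0 < bump t"
  by (auto simp: bump_def flat_0_eq)

lemma Ck_affine: "Ck k (\<lambda>t::real. c * t + b)"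
  using Ck_add[OF Ck_mult[OF Ck_const[of k c] Ck_inner_left[of k "1::real"]] Ck_const[of k b]] by simp

lemma test_function_bump:
  assumes "\<delta> > 0"
  shows "test_function UNIV (\<lambda>t. bump ((t - t0) / \<delta>))"
  unfolding test_function_def
proof (intro conjI allI exI[of _ "{t0 - \<delta>..t0 + \<delta>}"] impI)
  show "Ck k (\<lambda>t. bump ((t - t0) / \<delta>))" for k
  proof -
    have "Ck k (\<lambda>t. flat 0 (inverse \<delta> * t + (- t0 / \<delta> - 1)))"
      "Ck k (\<lambda>t. flat 0 (- inverse \<delta> * t + (t0 / \<delta> - 1)))"
      by (intro Ck_compose[of flat] flat_has_real_derivative Ck_affine)+
    moreover have "(t - t0) / \<delta> - 1 = inverse \<delta> * t + (- t0 / \<delta> - 1)"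
      "- ((t - t0) / \<delta>) - 1 = - inverse \<delta> * t + (t0 / \<delta> - 1)" for t
      by (simp_all add: divide_inverse algebra_simps)
    ultimately show ?thesis
      unfolding bump_def by (simp only: Ck_mult)
  qed
  show "bump ((t - t0) / \<delta>) = 0" if "t \<notin> {t0 - \<delta>..t0 + \<delta>}" for t
    using that assms by (intro bump_eq_0) (auto simp: field_simps)
qed auto

text \<open>A zero integral would make \<open>bump\<close> vanish almost everywhere, so the interval
  (-1,1) would be null.\<close>

lemma integral_bump_pos: "0 < (\<integral>t. bump t \<partial>lborel)"
proof -
  have "test_function UNIV bump" using test_function_bump[of 1 0] by simp
  then have cont: "continuous_on UNIV bump" by (rule test_functionD)
  have int: "integrable lborel bump"
    by (rule integrable_lborel_compact_support[OF cont, of "{-1..1}"]) (auto intro!: bump_eq_0)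
  have "(\<integral>t. bump t \<partial>lborel) \<noteq> 0"
  proof
    assume "(\<integral>t. bump t \<partial>lborel) = 0"
    then have "AE t in lborel. bump t = 0"
      using integral_nonneg_eq_0_iff_AE[OF int] bump_nonneg by simp
    then have "AE t in lborel. t \<notin> {-1<..<(1::real)}"
    proof eventually_elim
      case (elim t)
      then show ?case using bump_pos[of t] by (auto simp: abs_less_iff)
    qed
    then have "emeasure lborel {-1<..<(1::real)} = 0"
      by (subst (asm) AE_iff_measurable[of "{-1<..<(1::real)}"]) auto
    then show False by simp
  qed
  moreover have "0 \<le> (\<integral>t. bump t \<partial>lborel)"
    by (simp add: bump_nonneg)
  ultimately show ?thesis by linarith
qed

lemma gradient_real:
  assumes "(f has_real_derivative d) (at t)"
  shows "gradient f t = d"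
  using gradient_inner_Basis[of f "(*) d" t 1] assms by (simp add: has_field_derivative_def)

text \<open>Rescaled bumps at \<open>t0\<close> turn the weak derivative into \<open>D\<close>; only differentiability at the
  single point \<open>t0\<close> is used.\<close>

lemma abs_derivative_le_of_weak_gradient:
  fixes a a' :: "real \<Rightarrow> real"
  assumes cont: "continuous_on UNIV a" and weak: "has_weak_gradient UNIV a a'"
    and D: "(a has_real_derivative D) (at t0)"
    and \<epsilon>: "\<epsilon> > 0" and bound: "AE t in lebesgue. \<bar>t - t0\<bar> \<le> \<epsilon> \<longrightarrow> \<bar>a' t\<bar> \<le> K" and "K \<ge> 0"
  shows "\<bar>D\<bar> \<le> K"
proof -
  define G where "G = gradient bump"
  have bump: "test_function UNIV bump" using test_function_bump[of 1 0] by simp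
  note bumpD = test_functionD[OF bump]
  have contG: "continuous_on UNIV G" unfolding G_def by (rule bumpD)
  note [measurable] = borel_measurable_continuous_onI[OF cont]
    borel_measurable_continuous_onI[OF bumpD(1)] borel_measurable_continuous_onI[OF contG]
  have derG: "(bump has_real_derivative G t) (at t)" for t
    using has_derivative_gradient[OF bumpD(3)[of t]]
    by (simp add: has_field_derivative_def G_def)
  have G0: "G t = 0" if "1 < \<bar>t\<bar>" for t
  proof -
    have "(bump has_real_derivative 0) (at t)"
      by (rule has_field_derivative_transform_within_open[of "\<lambda>_. 0" _ _ "- {-1..1}"])
        (use that in \<open>auto simp: bump_eq_0 abs_if split: if_splits\<close>)
    then show ?thesis using derG[of t] DERIV_unique by blast
  qed
  have intG: "integrable lborel G" "integrable lborel (\<lambda>t. t * G t)" "integrable lborel bump"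
    by (rule integrable_lborel_compact_support[of _ "{-1..1}"];
        auto intro!: continuous_intros contG bumpD G0 bump_eq_0)+
  \<comment> \<open>The two moments of G that matter: order 0 allows a(t0) to be subtracted from a
    under the integral, and order 1 turns the limit D s G(s) into -D times the integral of
    \<open>bump\<close>.\<close>
  have int_G: "(\<integral>t. G t \<partial>lborel) = 0"
    using integral_gradient_test_function[OF bump, of 1] by (simp add: G_def)
  have int_sG: "(\<integral>t. t * G t \<partial>lborel) = - (\<integral>t. bump t \<partial>lborel)"
  proof -
    have tf: "test_function UNIV (\<lambda>t. t * bump t)"
      using test_function_mult[OF bump Ck_affine[of _ 1 0]] by simp
    have "gradient (\<lambda>t. t * bump t) t = t * G t + bump t" for t
      by (rule gradient_real) (auto intro!: derivative_eq_intros derG)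
    then have "(\<integral>t. t * G t + bump t \<partial>lborel) = 0"
      using integral_gradient_test_function[OF tf, of 1] by simp
    then show ?thesis using intG by simp
  qed
  \<comment> \<open>The weak derivative identity is tested with the bump of width
    \<open>\<delta>\<close> and rescaled by t = t0 + \<open>\<delta>\<close> s. The condition
    \<open>\<delta> \<le> \<epsilon>\<close> keeps the bump inside the interval where
    \<open>a'\<close> is bounded by \<open>K\<close>.\<close>
  have scaled: "\<bar>\<integral>s. (a (t0 + \<delta> * s) - a t0) / \<delta> * G s \<partial>lborel\<bar> \<le> K * (\<integral>s. bump s \<partial>lborel)"
    if \<delta>: "0 < \<delta>" "\<delta> \<le> \<epsilon>" for \<delta>
  proof -
    define \<psi> where "\<psi> t = bump ((t - t0) / \<delta>)" for t
    have \<psi>: "test_function UNIV \<psi>" unfolding \<psi>_def[abs_def] by (rule test_function_bump[OF \<delta>(1)])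
    have "(\<psi> has_real_derivative G ((t - t0) / \<delta>) / \<delta>) (at t)" for t
    proof -
      have "((\<lambda>t. (t - t0) / \<delta>) has_real_derivative 1 / \<delta>) (at t)"
        using \<delta>(1) by (auto intro!: derivative_eq_intros)
      from DERIV_chain2[OF derG this] show ?thesis by (simp add: \<psi>_def[abs_def])
    qed
    then have grad: "gradient \<psi> t = G ((t - t0) / \<delta>) / \<delta>" for t
      by (rule gradient_real)
    have "(\<integral>t. a t * gradient \<psi> t \<partial>lebesgue) = - (\<integral>t. a' t * \<psi> t \<partial>lebesgue)"
      using weak \<psi> by (simp add: has_weak_gradient_def lebesgue_on_UNIV_eq)
    moreover have "(\<integral>t. a t * gradient \<psi> t \<partial>lebesgue) = (\<integral>t. a t * gradient \<psi> t \<partial>lborel)"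
      unfolding grad by (rule integral_completion) measurable
    moreover have "(\<integral>t. a t * gradient \<psi> t \<partial>lborel) = (\<integral>s. a (t0 + \<delta> * s) * G s \<partial>lborel)"
      unfolding grad using \<delta> by (subst lborel_integral_real_affine[of \<delta> _ t0]) auto
    moreover have "(\<integral>s. a (t0 + \<delta> * s) * G s \<partial>lborel) = (\<integral>s. (a (t0 + \<delta> * s) - a t0) * G s \<partial>lborel)"
    proof -
      have "integrable lborel (\<lambda>s. a (t0 + \<delta> * s) * G s)"
        by (rule integrable_lborel_compact_support[of _ "{-1..1}"])
          (auto intro!: continuous_intros contG G0 continuous_on_compose2[OF cont])
      then have "(\<integral>s. a (t0 + \<delta> * s) * G s - a t0 * G s \<partial>lborel) = (\<integral>s. a (t0 + \<delta> * s) * G s \<partial>lborel)"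
        using intG int_G by simp
      then show ?thesis by (simp add: left_diff_distrib)
    qed
    ultimately have eq: "(\<integral>s. (a (t0 + \<delta> * s) - a t0) * G s \<partial>lborel) = - (\<integral>t. a' t * \<psi> t \<partial>lebesgue)"
      by simp
    have \<psi>_int: "integrable lborel \<psi>" "(\<integral>t. \<psi> t \<partial>lborel) = \<delta> * (\<integral>s. bump s \<partial>lborel)"
    proof -
      show "(\<integral>t. \<psi> t \<partial>lborel) = \<delta> * (\<integral>s. bump s \<partial>lborel)"
        using \<delta> by (subst lborel_integral_real_affine[of \<delta> _ t0]) (auto simp: \<psi>_def)
      show "integrable lborel \<psi>"
        using intG(3) \<delta> lborel_integrable_real_affine_iff[of \<delta> \<psi> t0] by (simp add: \<psi>_def)
    qed
    have \<psi>_meas: "\<psi> \<in> borel_measurable lborel" using \<psi>_int by auto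
    have "\<bar>\<integral>t. a' t * \<psi> t \<partial>lebesgue\<bar> \<le> (\<integral>t. \<bar>a' t * \<psi> t\<bar> \<partial>lebesgue)"
      by (rule integral_abs_bound)
    also have "\<dots> \<le> (\<integral>t. K * \<psi> t \<partial>lebesgue)"
    \<comment> \<open>This comparison asks for integrability of the majorant only; its nonnegativity
      covers the case where the left integral takes the default value 0.\<close>
    proof (rule integral_mono_AE')
      show "integrable lebesgue (\<lambda>t. K * \<psi> t)"
        using \<psi>_int \<psi>_meas by (auto simp: integrable_completion)
      show "AE t in lebesgue. \<bar>a' t * \<psi> t\<bar> \<le> K * \<psi> t"
        using bound
      proof eventually_elim
        case (elim t)
        show ?case
        proof (cases "\<bar>t - t0\<bar> \<le> \<epsilon>")
          case True
          then show ?thesis using elim bump_nonneg by (auto simp: \<psi>_def abs_mult intro!: mult_right_mono)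
        next
          case False
          then have "\<psi> t = 0" unfolding \<psi>_def using \<delta> by (intro bump_eq_0) (auto simp: field_simps)
          then show ?thesis by simp
        qed
      qed
      show "AE t in lebesgue. 0 \<le> K * \<psi> t"
        using \<open>K \<ge> 0\<close> bump_nonneg by (simp add: \<psi>_def)
    qed
    also have "\<dots> = K * (\<delta> * (\<integral>s. bump s \<partial>lborel))"
      using \<psi>_int \<psi>_meas by (simp add: integral_completion)
    finally have "\<bar>\<integral>s. (a (t0 + \<delta> * s) - a t0) * G s \<partial>lborel\<bar> \<le> K * (\<delta> * (\<integral>s. bump s \<partial>lborel))"
      by (simp add: eq)
    moreover have "(\<integral>s. (a (t0 + \<delta> * s) - a t0) / \<delta> * G s \<partial>lborel)
        = (\<integral>s. (a (t0 + \<delta> * s) - a t0) * G s \<partial>lborel) / \<delta>"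
      by simp
    ultimately show ?thesis using \<delta> by (simp add: field_simps)
  qed
  have "((\<lambda>h. (a (t0 + h) - a t0) / h) \<longlongrightarrow> D) (at 0)"
    using D by (simp add: DERIV_def)
  then have "eventually (\<lambda>h. dist ((a (t0 + h) - a t0) / h) D < 1) (at 0)"
    by (rule tendstoD) simp
  then obtain \<eta> where \<eta>: "\<eta> > 0" "\<And>h. h \<noteq> 0 \<Longrightarrow> \<bar>h\<bar> < \<eta> \<Longrightarrow> dist ((a (t0 + h) - a t0) / h) D < 1"
    by (auto simp: eventually_at)
  \<comment> \<open>Below \<open>\<epsilon>\<close> for the scaled bound, and below
    \<open>\<eta>\<close> so that for every nonzero s in [-1,1] the difference quotient at
    \<open>\<delta> n * s\<close> is within 1 of \<open>D\<close>; this yields the majorant.\<close>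
  define \<delta> where "\<delta> n = min \<epsilon> (\<eta> / 2) / real (Suc n)" for n
  have \<delta>: "0 < \<delta> n" "\<delta> n \<le> \<epsilon>" "\<delta> n < \<eta>" for n
  proof -
    have "\<delta> n \<le> min \<epsilon> (\<eta> / 2) / 1"
      unfolding \<delta>_def using \<epsilon> \<eta>(1) by (intro divide_left_mono) auto
    then show "\<delta> n \<le> \<epsilon>" "\<delta> n < \<eta>" using \<eta>(1) by auto
    show "0 < \<delta> n" using \<epsilon> \<eta>(1) by (simp add: \<delta>_def)
  qed
  have \<delta>0: "\<delta> \<longlonglongrightarrow> 0"
    unfolding \<delta>_def[abs_def] by (rule LIMSEQ_Suc[OF lim_const_over_n])
  have "(\<lambda>n. \<integral>s. (a (t0 + \<delta> n * s) - a t0) / \<delta> n * G s \<partial>lborel) \<longlonglongrightarrow> (\<integral>s. D * (s * G s) \<partial>lborel)"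
  proof (rule integral_dominated_convergence[where w = "\<lambda>s. (\<bar>D\<bar> + 1) * \<bar>G s\<bar>"])
    show "integrable lborel (\<lambda>s. (\<bar>D\<bar> + 1) * \<bar>G s\<bar>)" using intG by simp
    show "AE s in lborel. (\<lambda>n. (a (t0 + \<delta> n * s) - a t0) / \<delta> n * G s) \<longlonglongrightarrow> D * (s * G s)"
    proof (rule AE_I2)
      fix s
      have "((\<lambda>h. a (t0 + h * s)) has_real_derivative D * s) (at 0)"
        by (rule DERIV_chain2[of a D]) (use D in \<open>auto intro!: derivative_eq_intros\<close>)
      then have "((\<lambda>h. (a (t0 + h * s) - a t0) / h) \<longlongrightarrow> D * s) (at 0)"
        by (simp add: DERIV_def)
      moreover have "filterlim \<delta> (at 0) sequentially"
        using \<delta>0 \<delta>(1) by (auto simp: filterlim_at less_imp_neq[symmetric] intro!: always_eventually)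
      ultimately have "(\<lambda>n. (a (t0 + \<delta> n * s) - a t0) / \<delta> n) \<longlonglongrightarrow> D * s"
        by (rule filterlim_compose)
      from tendsto_mult_right[OF this, of "G s"]
      show "(\<lambda>n. (a (t0 + \<delta> n * s) - a t0) / \<delta> n * G s) \<longlonglongrightarrow> D * (s * G s)"
        by (simp add: mult.assoc)
    qed
    show "AE s in lborel. norm ((a (t0 + \<delta> n * s) - a t0) / \<delta> n * G s) \<le> (\<bar>D\<bar> + 1) * \<bar>G s\<bar>" for n
    proof (rule AE_I2)
      fix s
      show "norm ((a (t0 + \<delta> n * s) - a t0) / \<delta> n * G s) \<le> (\<bar>D\<bar> + 1) * \<bar>G s\<bar>"
      \<comment> \<open>At s = 0 the numerator is 0, and beyond 1 the factor \<open>G s\<close> is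
        0.\<close>
      proof (cases "s = 0 \<or> 1 < \<bar>s\<bar>")
        case True
        then show ?thesis using G0[of s] by auto
      next
        case False
        define h where "h = \<delta> n * s"
        have "\<bar>h\<bar> \<le> \<delta> n" using False \<delta>(1)[of n] by (simp add: h_def abs_mult)
        then have "h \<noteq> 0" "\<bar>h\<bar> < \<eta>" using False \<delta>[of n] by (auto simp: h_def)
        then have "dist ((a (t0 + h) - a t0) / h) D < 1" by (rule \<eta>(2))
        then have "\<bar>(a (t0 + h) - a t0) / h\<bar> \<le> \<bar>D\<bar> + 1" by (simp add: dist_real_def)
        then have "\<bar>(a (t0 + h) - a t0) / h\<bar> * \<bar>s\<bar> \<le> (\<bar>D\<bar> + 1) * 1"
          using False by (intro mult_mono) auto
        moreover have "(a (t0 + h) - a t0) / h * s = (a (t0 + \<delta> n * s) - a t0) / \<delta> n"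
          using False by (simp add: h_def)
        ultimately have "\<bar>(a (t0 + \<delta> n * s) - a t0) / \<delta> n\<bar> \<le> \<bar>D\<bar> + 1"
          by (metis abs_mult mult.right_neutral)
        then show ?thesis
          unfolding real_norm_def abs_mult by (intro mult_right_mono) auto
      qed
    qed
  qed measurable
  then have "(\<lambda>n. \<bar>\<integral>s. (a (t0 + \<delta> n * s) - a t0) / \<delta> n * G s \<partial>lborel\<bar>) \<longlonglongrightarrow> \<bar>\<integral>s. D * (s * G s) \<partial>lborel\<bar>"
    by (rule tendsto_rabs)
  then have "\<bar>\<integral>s. D * (s * G s) \<partial>lborel\<bar> \<le> K * (\<integral>s. bump s \<partial>lborel)"
    by (rule LIMSEQ_le_const2) (use scaled \<delta> in blast)
  then have "\<bar>D\<bar> * (\<integral>s. bump s \<partial>lborel) \<le> K * (\<integral>s. bump s \<partial>lborel)"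
    using integral_bump_pos by (simp add: int_sG abs_mult)
  then show ?thesis using integral_bump_pos by simp
qed

section \<open>The nonlocal operator and stability\<close>

text \<open>The set where the bound fails is open, and a nonempty open set is not null.\<close>

lemma AE_lebesgue_continuous_le:
  fixes f :: "'a::euclidean_space \<Rightarrow> real"
  assumes "continuous_on UNIV f" "AE x in lebesgue. f x \<le> M"
  shows "f x \<le> M"
proof -
  have op: "open {x. M < f x}"
    using assms(1) by (intro open_Collect_less) (auto intro: continuous_intros)
  have "{x. M < f x} \<in> null_sets lebesgue"
    using assms(2) AE_iff_null[of lebesgue "\<lambda>x. f x \<le> M"] op by (simp add: not_le)
  then have "{x. M < f x} = {}"
    using open_not_negligible[OF op] by (auto simp: negligible_iff_null_sets)
  then show ?thesis by (auto simp: not_less[symmetric])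
qed

text \<open>An \<open>INF\<close> over the reals is a lower bound only if the range is bounded
  below. That follows from the essential bound on \<open>a\<close>, which continuity extends to
  every point.\<close>

lemma W1inf_pos:
  assumes "W1inf a a'" "(INF t. a t) > 0"
  shows "a t > 0"
proof -
  have cont: "continuous_on UNIV a" and "Linf UNIV a" using assms(1) by (auto simp: W1inf_def)
  then have lt: "Linf_norm UNIV a < \<infinity>" by (simp add: Linf_def)
  have ae: "AE t in lebesgue. ereal \<bar>a t\<bar> \<le> Linf_norm UNIV a"
    unfolding Linf_norm_def lebesgue_on_UNIV_eq by (rule esssup_AE)
  obtain M where M: "Linf_norm UNIV a \<le> ereal M"
  proof (cases "Linf_norm UNIV a")
    case (real M)
    then show ?thesis by (intro that[of M]) simp
  qed (use lt that[of 0] in simp_all)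
  have "AE t in lebesgue. - a t \<le> M"
    using ae
  proof eventually_elim
    case (elim t)
    from order_trans[OF this M] show ?case by (simp add: abs_le_iff)
  qed
  then have "- a s \<le> M" for s
    by (rule AE_lebesgue_continuous_le[rotated]) (intro continuous_intros cont)
  then have "bdd_below (range a)" by (intro bdd_belowI[of _ "- M"]) (auto simp: minus_le_iff)
  then have "(INF t. a t) \<le> a t" by (rule cINF_lower) simp
  then show ?thesis using assms(2) by linarith
qed

text \<open>Makes the smallness condition, stated in extended reals, a real inequality. On a null
  interval the essential supremum would be minus infinity, so \<open>p < q\<close> secures
  nonnegativity.\<close>

lemma W1inf_Linf_norm_real:
  assumes "W1inf a a'" "p < q"
  obtains K where "Linf_norm {p..q} a' = ereal K" "K \<ge> 0"
proof -
  have meas: "a' \<in> borel_measurable lebesgue" and lt: "Linf_norm UNIV a' < \<infinity>"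
    using assms(1) by (auto simp: W1inf_def Linf_def lebesgue_on_UNIV_eq)
  have ae: "AE t in lebesgue. ereal \<bar>a' t\<bar> \<le> Linf_norm UNIV a'"
    unfolding Linf_norm_def lebesgue_on_UNIV_eq by (rule esssup_AE)
  have m: "(\<lambda>t. ereal \<bar>a' t\<bar>) \<in> borel_measurable (lebesgue_on {p..q})"
    using measurable_restrict_space1[OF meas, of "{p..q}"] by measurable
  have "Linf_norm {p..q} a' \<le> Linf_norm UNIV a'"
    unfolding Linf_norm_def[of "{p..q}"]
    by (rule esssup_I[OF m]) (use ae in \<open>auto simp: AE_restrict_space_iff\<close>)
  then have "Linf_norm {p..q} a' < \<infinity>" using lt by (rule le_less_trans)
  moreover have "0 \<le> Linf_norm {p..q} a'"
  proof -
    have "esssup (lebesgue_on {p..q}) (\<lambda>t. 0 :: ereal) \<le> Linf_norm {p..q} a'"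
      unfolding Linf_norm_def by (intro esssup_mono) auto
    moreover have "emeasure (lebesgue_on {p..q}) (space (lebesgue_on {p..q})) \<noteq> 0"
      using assms(2) by (simp add: emeasure_restrict_space)
    ultimately show ?thesis by (simp add: esssup_const)
  qed
  ultimately obtain K where "Linf_norm {p..q} a' = ereal K"
    by (cases "Linf_norm {p..q} a'") simp_all
  with \<open>0 \<le> Linf_norm {p..q} a'\<close> show thesis
    by (intro that[of K]) simp_all
qed

text \<open>The averaging argument needs a whole neighbourhood of \<open>t0\<close> in the interval,
  hence the strict inequalities. Where \<open>a\<close> is not differentiable, \<open>a'\<close> has
  the value 0 by convention.\<close>

lemma W1inf_abs_derivative_le:
  assumes W: "W1inf a a'" and K: "Linf_norm {p..q} a' = ereal K" "K \<ge> 0" and t0: "p < t0" "t0 < q"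
  shows "\<bar>a' t0\<bar> \<le> K"
proof (cases "a differentiable (at t0)")
  case True
  define \<epsilon> where "\<epsilon> = min (t0 - p) (q - t0)"
  have "AE t in lebesgue_on {p..q}. ereal \<bar>a' t\<bar> \<le> ereal K"
    using esssup_AE[of "\<lambda>t. ereal \<bar>a' t\<bar>" "lebesgue_on {p..q}"] K(1) by (simp add: Linf_norm_def)
  then have "AE t in lebesgue. \<bar>t - t0\<bar> \<le> \<epsilon> \<longrightarrow> \<bar>a' t\<bar> \<le> K"
    by (subst (asm) AE_restrict_space_iff) (auto simp: \<epsilon>_def abs_le_iff elim!: eventually_mono)
  moreover have "(a has_real_derivative a' t0) (at t0)"
    using True W by (auto simp: W1inf_def DERIV_deriv_iff_real_differentiable)
  ultimately show ?thesis
    using W t0 K(2) by (intro abs_derivative_le_of_weak_gradient[of a a' _ t0 \<epsilon>]) (auto simp: W1inf_def \<epsilon>_def)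
next
  case False
  then show ?thesis using W K(2) by (simp add: W1inf_def)
qed

section \<open>The nonlocal operator: continuity and bounds\<close>

lemma l_op_eq_integral:
  assumes "\<Omega> \<in> sets lebesgue"
  shows "l_op \<Omega> g r v x = (\<integral>y. (if y \<in> cball x r then g y * v y else 0) \<partial>lebesgue_on \<Omega>)"
  using Lebesgue_Measure.integral_restrict_Int[of "cball x r" \<Omega> "\<lambda>y. g y * v y"] assms
  by (simp add: l_op_def Int_commute)

lemma integrable_l_op:
  assumes "\<Omega> \<in> sets lebesgue" "integrable (lebesgue_on \<Omega>) h"
  shows "integrable (lebesgue_on \<Omega>) (\<lambda>y. if y \<in> cball x r then h y else (0::real))"
proof -
  have "cball x r \<inter> \<Omega> \<in> sets (lebesgue_on \<Omega>)"
    using assms(1) by (subst sets_restrict_space_iff) auto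
  then have "integrable (lebesgue_on \<Omega>) (\<lambda>y. indicator (cball x r \<inter> \<Omega>) y * h y)"
    using integrable_mult_indicator[OF _ assms(2)] by simp
  then show ?thesis
    by (subst Bochner_Integration.integrable_cong[OF refl]) (auto simp: indicator_def)
qed

text \<open>When the centre moves, the indicator of the ball converges at every point off the
  sphere, a null set, and |g v| dominates. Continuity makes the coefficient a(l_r(u))
  measurable.\<close>

lemma continuous_l_op:
  assumes \<Omega>: "\<Omega> \<in> sets lebesgue" and int: "integrable (lebesgue_on \<Omega>) (\<lambda>y. g y * v y)"
  shows "continuous_on UNIV (l_op \<Omega> g r v)"
proof -
  define h where "h y = g y * v y" for y
  have int_h: "integrable (lebesgue_on \<Omega>) h" using int by (simp add: h_def[abs_def])
  have "isCont (l_op \<Omega> g r v) x" for x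
    unfolding continuous_at_sequentially
  proof (intro allI impI)
    fix X assume X: "X \<longlonglongrightarrow> x"
    have "(\<lambda>n. \<integral>y. (if y \<in> cball (X n) r then h y else 0) \<partial>lebesgue_on \<Omega>)
        \<longlonglongrightarrow> (\<integral>y. (if y \<in> cball x r then h y else 0) \<partial>lebesgue_on \<Omega>)"
    proof (rule integral_dominated_convergence[where w = "\<lambda>y. \<bar>h y\<bar>"])
      have "AE y in lebesgue. y \<notin> sphere x r"
        using negligible_sphere[of x r] by (intro AE_not_in) (simp add: negligible_iff_null_sets)
      then have "AE y in lebesgue_on \<Omega>. y \<notin> sphere x r"
        using \<Omega> by (auto simp: AE_restrict_space_iff elim: eventually_mono)
      then show "AE y in lebesgue_on \<Omega>.
          (\<lambda>n. if y \<in> cball (X n) r then h y else 0) \<longlonglongrightarrow> (if y \<in> cball x r then h y else 0)"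
      proof eventually_elim
        case (elim y)
        have lim: "(\<lambda>n. dist (X n) y) \<longlonglongrightarrow> dist x y" by (intro tendsto_intros X)
        consider "dist x y < r" | "dist x y > r" using elim by force
        then have "eventually (\<lambda>n. (if y \<in> cball (X n) r then h y else 0) = (if y \<in> cball x r then h y else 0)) sequentially"
        proof cases
          case 1
          show ?thesis
            by (rule eventually_mono[OF order_tendstoD(2)[OF lim 1]]) (use 1 in auto)
        next
          case 2
          show ?thesis
            by (rule eventually_mono[OF order_tendstoD(1)[OF lim 2]]) (use 2 in auto)
        qed
        then show ?case by (rule tendsto_eventually)
      qed
    qed (use int_h in \<open>auto intro!: borel_measurable_integrable integrable_l_op[OF \<Omega>] simp del: mem_cball\<close>)
    then show "(l_op \<Omega> g r v \<circ> X) \<longlonglongrightarrow> l_op \<Omega> g r v x"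
      unfolding o_def l_op_eq_integral[OF \<Omega>] h_def .
  qed
  then show ?thesis by (simp add: continuous_at_imp_continuous_on)
qed

text \<open>The almost everywhere hypotheses enter only under the integral, so the conclusions hold
  for every centre \<open>x\<close>.\<close>

lemma l_op_bounds:
  assumes \<Omega>: "\<Omega> \<in> sets lebesgue" and L: "L2 \<Omega> g" "L2 \<Omega> v" "L2 \<Omega> w"
    and g: "AE x in lebesgue_on \<Omega>. 0 \<le> g x"
    and v: "AE x in lebesgue_on \<Omega>. 0 \<le> v x" "AE x in lebesgue_on \<Omega>. v x \<le> w x"
  shows "0 \<le> l_op \<Omega> g r v x" "l_op \<Omega> g r v x \<le> l_full \<Omega> g w"
proof -
  show "0 \<le> l_op \<Omega> g r v x"
    unfolding l_op_eq_integral[OF \<Omega>]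
    by (rule integral_nonneg_AE) (use g v(1) in eventually_elim, auto)
  show "l_op \<Omega> g r v x \<le> l_full \<Omega> g w"
    unfolding l_op_eq_integral[OF \<Omega>] l_full_def
  proof (rule integral_mono_AE)
    show "AE y in lebesgue_on \<Omega>. (if y \<in> cball x r then g y * v y else 0) \<le> g y * w y"
      using g v by eventually_elim (auto intro: mult_left_mono)
  qed (intro integrable_l_op \<Omega> integrable_mult_of_L2 L)+
qed

lemma abs_l_op_le:
  assumes \<Omega>: "\<Omega> \<in> sets lebesgue" and L: "L2 \<Omega> g" "L2 \<Omega> v"
  shows "\<bar>l_op \<Omega> g r v x\<bar> \<le> L2_norm \<Omega> g * L2_norm \<Omega> v"
proof -
  have "\<bar>l_op \<Omega> g r v x\<bar> \<le> (\<integral>y. \<bar>if y \<in> cball x r then g y * v y else 0\<bar> \<partial>lebesgue_on \<Omega>)"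
    unfolding l_op_eq_integral[OF \<Omega>] by (rule integral_abs_bound)
  also have "\<dots> \<le> (\<integral>y. \<bar>g y * v y\<bar> \<partial>lebesgue_on \<Omega>)"
    by (intro integral_mono integrable_abs integrable_l_op \<Omega> integrable_mult_of_L2 L) auto
  also have "\<dots> \<le> L2_norm \<Omega> g * L2_norm \<Omega> v"
    using L integral_abs_mult_le_L2[of g "lebesgue_on \<Omega>" v] by (simp add: L2_real L2_norm_real)
  finally show ?thesis .
qed

text \<open>A ball of radius 0 is a single point; hence the problem at radius 0 has the constant
  coefficient a(0).\<close>

lemma l_op_zero_radius: "l_op \<Omega> g 0 v x = 0"
proof -
  have "negligible (\<Omega> \<inter> cball x 0)"
    by (rule negligible_subset[OF negligible_sing[of x]]) simp
  then show ?thesis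
    unfolding l_op_def negligible_iff_null_sets by (rule integral_eq_zero_null_sets)
qed

text \<open>Stated for an arbitrary dominated \<open>F\<close>, so that it applies directly to the
  stability integrand with its composition of \<open>a'\<close> and l_r(u_r).\<close>

lemma abs_integral_le_of_L2:
  assumes L: "L2 \<Omega> u" "L2 \<Omega> v" and "C \<ge> 0"
    and le: "\<And>x. x \<in> \<Omega> \<Longrightarrow> \<bar>F x\<bar> \<le> C * (norm (u x) * norm (v x))"
  shows "\<bar>\<integral>x. F x \<partial>lebesgue_on \<Omega>\<bar> \<le> C * (L2_norm \<Omega> u * L2_norm \<Omega> v)"
proof -
  have L': "L2 \<Omega> (\<lambda>x. norm (u x))" "L2 \<Omega> (\<lambda>x. norm (v x))" using L by (auto simp: L2_def)
  have "\<bar>\<integral>x. F x \<partial>lebesgue_on \<Omega>\<bar> \<le> (\<integral>x. \<bar>F x\<bar> \<partial>lebesgue_on \<Omega>)"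
    by (rule integral_abs_bound)
  also have "\<dots> \<le> (\<integral>x. C * (norm (u x) * norm (v x)) \<partial>lebesgue_on \<Omega>)"
    by (rule integral_mono_AE') (use le \<open>C \<ge> 0\<close> in \<open>auto intro!: integrable_mult_of_L2 L'\<close>)
  also have "\<dots> = C * (\<integral>x. norm (u x) * norm (v x) \<partial>lebesgue_on \<Omega>)" by simp
  also have "(\<integral>x. norm (u x) * norm (v x) \<partial>lebesgue_on \<Omega>) \<le> L2_norm \<Omega> u * L2_norm \<Omega> v"
    using abs_integral_mult_of_L2[OF L'] by (simp add: L2_norm_def)
  finally show ?thesis using \<open>C \<ge> 0\<close> by (simp add: mult_left_mono)
qed

text \<open>The upper bound \<open>M\<close> makes the weighted integrand integrable; otherwise its
  integral could be the default value 0.\<close>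

lemma integral_coefficient_ge:
  assumes L: "L2 \<Omega> u" and A: "A \<in> borel_measurable (lebesgue_on \<Omega>)"
    and bounds: "\<And>x. x \<in> \<Omega> \<Longrightarrow> m \<le> A x" "\<And>x. x \<in> \<Omega> \<Longrightarrow> A x \<le> M" and "0 \<le> m"
  shows "m * (L2_norm \<Omega> u)\<^sup>2 \<le> (\<integral>x. A x * (norm (u x))\<^sup>2 \<partial>lebesgue_on \<Omega>)"
proof -
  have [measurable]: "u \<in> borel_measurable (lebesgue_on \<Omega>)" and int: "integrable (lebesgue_on \<Omega>) (\<lambda>x. (norm (u x))\<^sup>2)"
    using L by (auto simp: L2_def)
  note [measurable] = A
  have "(\<integral>x. m * (norm (u x))\<^sup>2 \<partial>lebesgue_on \<Omega>) \<le> (\<integral>x. A x * (norm (u x))\<^sup>2 \<partial>lebesgue_on \<Omega>)"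
  proof (rule integral_mono)
    show "integrable (lebesgue_on \<Omega>) (\<lambda>x. A x * (norm (u x))\<^sup>2)"
    proof (rule Bochner_Integration.integrable_bound)
      show "integrable (lebesgue_on \<Omega>) (\<lambda>x. M * (norm (u x))\<^sup>2)" using int by simp
      have "\<bar>A x\<bar> \<le> \<bar>M\<bar>" if "x \<in> \<Omega>" for x using bounds[OF that] \<open>0 \<le> m\<close> by linarith
      then show "AE x in lebesgue_on \<Omega>. norm (A x * (norm (u x))\<^sup>2) \<le> norm (M * (norm (u x))\<^sup>2)"
        by (intro AE_I2) (auto simp: abs_mult intro!: mult_right_mono)
    qed measurable
  qed (use int bounds in \<open>auto intro!: mult_right_mono\<close>)
  then show ?thesis by (simp add: L2_norm_square)
qed

text \<open>The known existence of u_r enters as hypotheses on the family \<open>u\<close>: a global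
  branch of radial functions between \<open>u0\<close> and \<open>ud\<close>. The constant is chosen
  before all other data.\<close>

theorem proposition3p9:
  fixes d :: real and \<Omega> :: "(real ^ 'n) set"
  assumes "d > 0" and "\<Omega> = ball 0 (d/2)"
  shows "\<exists>C1 > 0. \<forall>f g a a' \<phi> D\<phi> \<mu>\<^sub>d u0 Du0 ud Dud u1 Du1 u Du \<epsilon>.
    L2_radial d f \<longrightarrow> L2_radial d g \<longrightarrow>
    (AE x in lebesgue_on \<Omega>. f x \<ge> 0) \<longrightarrow> (AE x in lebesgue_on \<Omega>. g x \<ge> 0) \<longrightarrow>
    W1inf a a' \<longrightarrow> (INF t. a t) > 0 \<longrightarrow>
    weak_solution \<Omega> (\<lambda>_. 1) f \<phi> D\<phi> \<longrightarrow>
    \<mu>\<^sub>d * a \<mu>\<^sub>d = l_full \<Omega> g \<phi> \<longrightarrow>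
    (\<forall>t\<in>{0..\<mu>\<^sub>d}. a \<mu>\<^sub>d \<le> a t) \<longrightarrow> (\<forall>t\<in>{0..\<mu>\<^sub>d}. a t \<le> a 0) \<longrightarrow>
    smallest_solution_P \<Omega> a g f d u1 Du1 \<longrightarrow>
    0 \<le> l_full \<Omega> g u1 \<longrightarrow> l_full \<Omega> g u1 \<le> \<mu>\<^sub>d \<longrightarrow>
    solves_P \<Omega> a g f 0 u0 Du0 \<longrightarrow>
    solves_P \<Omega> a g f d ud Dud \<longrightarrow> l_full \<Omega> g ud = \<mu>\<^sub>d \<longrightarrow>
    global_branch \<Omega> d a g f u Du \<longrightarrow>
    (\<forall>r\<in>{0..d}. L2_radial d (u r) \<and> u r \<in> order_interval \<Omega> u0 ud) \<longrightarrow>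
    \<epsilon> > 0 \<longrightarrow>
    ereal (C1 * L2_norm \<Omega> g * L2_norm \<Omega> f) * Linf_norm {-\<epsilon>..\<mu>\<^sub>d + \<epsilon>} a'
      * ereal (1 / (a \<mu>\<^sub>d)\<^sup>2) < 1 \<longrightarrow>
    (\<forall>r\<in>{0..d}. stable_solution \<Omega> a a' g r (u r) (Du r))"
proof (intro exI[of _ "d\<^sup>2"] conjI allI impI ballI)
  show "d\<^sup>2 > 0" using \<open>d > 0\<close> by simp
next
  fix f g a a' \<phi> D\<phi> \<mu> u0 Du0 ud Dud u1 Du1 u Du \<epsilon> r
  assume fg: "L2_radial d f" "L2_radial d g"
    and f0: "AE x in lebesgue_on \<Omega>. f x \<ge> 0" and g0: "AE x in lebesgue_on \<Omega>. g x \<ge> 0"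
    and W: "W1inf a a'" and inf: "(INF t. a t) > 0"
    and amin: "\<forall>t\<in>{0..\<mu>}. a \<mu> \<le> a t" and amax: "\<forall>t\<in>{0..\<mu>}. a t \<le> a 0"
    and l1: "0 \<le> l_full \<Omega> g u1" "l_full \<Omega> g u1 \<le> \<mu>"
    and u0: "solves_P \<Omega> a g f 0 u0 Du0"
    and ud: "solves_P \<Omega> a g f d ud Dud" "l_full \<Omega> g ud = \<mu>"
    and branch: "global_branch \<Omega> d a g f u Du"
    and interval: "\<forall>r\<in>{0..d}. L2_radial d (u r) \<and> u r \<in> order_interval \<Omega> u0 ud"
    and \<epsilon>: "\<epsilon> > 0"
    and small: "ereal (d\<^sup>2 * L2_norm \<Omega> g * L2_norm \<Omega> f) * Linf_norm {-\<epsilon>..\<mu> + \<epsilon>} a'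
      * ereal (1 / (a \<mu>)\<^sup>2) < 1"
    and r: "r \<in> {0..d}"
  have \<Omega>: "\<Omega> \<in> lmeasurable" "\<Omega> \<in> sets lebesgue" "bounded \<Omega>" "\<Omega> \<subseteq> cball 0 (d / 2)"
    using assms(2) by auto
  have L: "L2 \<Omega> f" "L2 \<Omega> g" using fg assms(2) by (auto simp: L2_radial_def)
  have \<mu>0: "0 \<le> \<mu>" using l1 by linarith
  have a_pos: "a t > 0" for t by (rule W1inf_pos[OF W inf])
  \<comment> \<open>The radius is d/2, so the constant 2 R equals d. It is spent once on u_r in the
    energy estimate and once on \<open>\<psi>\<close> in the bound of l_r(psi), which gives
    d^2.\<close>
  have Poincare: "L2_norm \<Omega> v \<le> d * L2_norm \<Omega> Dv" if "H10 \<Omega> v Dv" for v and Dv :: "real^'n \<Rightarrow> real^'n"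
    using Poincare_H10[OF \<Omega>(1,4) that] by simp
  have sol: "weak_solution \<Omega> (\<lambda>x. a (l_op \<Omega> g r (u r) x)) f (u r) (Du r)"
    using branch r by (simp add: global_branch_def solves_P_def)
  then have H: "H10 \<Omega> (u r) (Du r)" by (simp add: weak_solution_def)
  then have Lu: "L2 \<Omega> (u r)" "L2 \<Omega> (Du r)" by (auto simp: H10_def)
  have Lud: "L2 \<Omega> ud" using ud(1) by (simp add: solves_P_def weak_solution_def H10_def)
  have "weak_solution \<Omega> (\<lambda>_. a 0) f u0 Du0"
    using u0 by (simp add: solves_P_def l_op_zero_radius)
  then have "AE x in lebesgue_on \<Omega>. 0 \<le> u0 x"
    by (rule weak_solution_nonneg[OF \<Omega>(1,3) _ a_pos f0])
  moreover have iv: "AE x in lebesgue_on \<Omega>. u0 x \<le> u r x \<and> u r x \<le> ud x"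
    using interval r by (simp add: order_interval_def)
  ultimately have u_nonneg: "AE x in lebesgue_on \<Omega>. 0 \<le> u r x"
    by eventually_elim auto
  have u_le: "AE x in lebesgue_on \<Omega>. u r x \<le> ud x" using iv by eventually_elim auto
  define l where "l = l_op \<Omega> g r (u r)"
  have l: "0 \<le> l x" "l x \<le> \<mu>" for x
    using l_op_bounds[OF \<Omega>(2) L(2) Lu(1) Lud g0 u_nonneg u_le] ud(2) by (auto simp: l_def)
  \<comment> \<open>The lower bound gives coercivity; the upper bound a(0) keeps the weighted
    integrals meaningful.\<close>
  have A: "a \<mu> \<le> a (l x)" "a (l x) \<le> a 0" for x
    using l by (auto intro!: bspec[OF amin] bspec[OF amax])
  have "continuous_on UNIV a" using W by (simp add: W1inf_def)
  moreover have "continuous_on UNIV l"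
    unfolding l_def by (rule continuous_l_op[OF \<Omega>(2) integrable_mult_of_L2[OF L(2) Lu(1)]])
  ultimately have "continuous_on UNIV (\<lambda>x. a (l x))"
    by (rule continuous_on_compose2) simp
  then have "continuous_on \<Omega> (\<lambda>x. a (l x))"
    by (rule continuous_on_subset) simp
  then have A_meas: "(\<lambda>x. a (l x)) \<in> borel_measurable (lebesgue_on \<Omega>)"
    by (rule continuous_imp_measurable_on_sets_lebesgue) (rule \<Omega>)
  have coercive: "a \<mu> * (L2_norm \<Omega> v)\<^sup>2 \<le> (\<integral>x. a (l x) * (norm (v x))\<^sup>2 \<partial>lebesgue_on \<Omega>)"
    if "L2 \<Omega> v" for v :: "real^'n \<Rightarrow> real^'n"
    by (rule integral_coefficient_ge[OF that A_meas A(1) A(2) less_imp_le[OF a_pos]])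
  have "- \<epsilon> < \<mu> + \<epsilon>" using \<mu>0 \<epsilon> by linarith
  from W1inf_Linf_norm_real[OF W this] obtain K where
    K: "Linf_norm {-\<epsilon>..\<mu> + \<epsilon>} a' = ereal K" "K \<ge> 0" .
  \<comment> \<open>The margin \<open>\<epsilon>\<close> places the closed range
    [0,\<open>\<mu>\<close>] strictly inside the interval, so the endpoint values of l_r(u_r) are
    covered too.\<close>
  have a'_le: "\<bar>a' (l x)\<bar> \<le> K" for x
    using l[of x] \<epsilon> by (intro W1inf_abs_derivative_le[OF W K]) auto
  define F G where "F = L2_norm \<Omega> f" and "G = L2_norm \<Omega> g"
  have nn: "F \<ge> 0" "G \<ge> 0" by (auto simp: F_def G_def L2_norm_nonneg)
  have small': "d\<^sup>2 * G * F * K \<le> (a \<mu>)\<^sup>2"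
  proof -
    have "d\<^sup>2 * G * F * K * (1 / (a \<mu>)\<^sup>2) < 1"
      using small by (simp add: K(1) F_def G_def)
    then show ?thesis using a_pos[of \<mu>] by (simp add: divide_less_eq)
  qed
  define N where "N = L2_norm \<Omega> (Du r)"
  have N0: "N \<ge> 0" by (simp add: N_def L2_norm_nonneg)
  \<comment> \<open>The equation is tested with its own solution, and one factor \<open>N\<close> is
    cancelled.\<close>
  have energy: "a \<mu> * N \<le> d * F"
  proof -
    have "a \<mu> * N\<^sup>2 \<le> (\<integral>x. a (l x) * (norm (Du r x))\<^sup>2 \<partial>lebesgue_on \<Omega>)"
      unfolding N_def by (rule coercive[OF Lu(2)])
    also have "\<dots> = (\<integral>x. a (l x) * (Du r x \<bullet> Du r x) \<partial>lebesgue_on \<Omega>)"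
      by (simp add: power2_norm_eq_inner)
    also have "\<dots> = (\<integral>x. f x * u r x \<partial>lebesgue_on \<Omega>)"
      using sol H unfolding weak_solution_def l_def by blast
    also have "\<dots> \<le> F * L2_norm \<Omega> (u r)"
      using abs_integral_mult_of_L2[OF L(1) Lu(1)] by (simp add: F_def)
    also have "\<dots> \<le> F * (d * N)"
      unfolding N_def by (intro mult_left_mono Poincare H nn)
    finally have "(a \<mu> * N) * N \<le> (d * F) * N" by (simp add: power2_eq_square mult_ac)
    then show ?thesis using N0 nn \<open>d > 0\<close> by (cases "N = 0") auto
  qed
  \<comment> \<open>The energy estimate is inserted after multiplication by a(\<open>\<mu>\<close>),
    which explains the square of a(\<open>\<mu>\<close>) in the smallness condition.\<close>
  have contraction: "K * G * d * N \<le> a \<mu>"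
  proof -
    have "(K * G * d) * (a \<mu> * N) \<le> (K * G * d) * (d * F)"
      using K(2) nn \<open>d > 0\<close> by (intro mult_left_mono energy) simp
    also have "\<dots> = d\<^sup>2 * G * F * K" by (simp add: power2_eq_square)
    also have "\<dots> \<le> a \<mu> * a \<mu>" using small' by (simp add: power2_eq_square)
    finally have "a \<mu> * (K * G * d * N) \<le> a \<mu> * a \<mu>" by (simp add: mult_ac)
    then show ?thesis using a_pos[of \<mu>] by simp
  qed
  show "stable_solution \<Omega> a a' g r (u r) (Du r)"
    unfolding stable_solution_def
  proof (intro allI impI)
    fix \<psi> and D\<psi> :: "real^'n \<Rightarrow> real^'n"
    assume \<psi>: "H10 \<Omega> \<psi> D\<psi>"
    then have L\<psi>: "L2 \<Omega> \<psi>" "L2 \<Omega> D\<psi>" by (auto simp: H10_def)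
    define P where "P = L2_norm \<Omega> D\<psi>"
    have P0: "P \<ge> 0" by (simp add: P_def L2_norm_nonneg)
    have l\<psi>: "\<bar>l_op \<Omega> g r \<psi> x\<bar> \<le> G * (d * P)" for x
    proof -
      have "\<bar>l_op \<Omega> g r \<psi> x\<bar> \<le> G * L2_norm \<Omega> \<psi>"
        unfolding G_def by (rule abs_l_op_le[OF \<Omega>(2) L(2) L\<psi>(1)])
      also have "\<dots> \<le> G * (d * P)"
        unfolding P_def by (intro mult_left_mono Poincare[OF \<psi>] nn)
      finally show ?thesis .
    qed
    have "0 \<le> d * P" using P0 \<open>d > 0\<close> by simp
    from mult_nonneg_nonneg[OF K(2) mult_nonneg_nonneg[OF nn(2) this]]
    have C0: "0 \<le> K * (G * (d * P))" .
    have "\<bar>\<integral>x. a' (l x) * l_op \<Omega> g r \<psi> x * (Du r x \<bullet> D\<psi> x) \<partial>lebesgue_on \<Omega>\<bar>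
        \<le> K * (G * (d * P)) * (N * P)"
      unfolding N_def P_def
    proof (rule abs_integral_le_of_L2[OF Lu(2) L\<psi>(2) C0[unfolded P_def]])
      fix x
      show "\<bar>a' (l x) * l_op \<Omega> g r \<psi> x * (Du r x \<bullet> D\<psi> x)\<bar>
          \<le> K * (G * (d * L2_norm \<Omega> D\<psi>)) * (norm (Du r x) * norm (D\<psi> x))"
        unfolding abs_mult P_def[symmetric]
        by (rule mult_mono[OF mult_mono[OF a'_le l\<psi> K(2)] Cauchy_Schwarz_ineq2 C0]) auto
    qed
    also have "\<dots> = (K * G * d * N) * P\<^sup>2" by (simp add: power2_eq_square)
    also have "\<dots> \<le> a \<mu> * P\<^sup>2"
      by (intro mult_right_mono contraction) simp
    also have "\<dots> \<le> (\<integral>x. a (l x) * (norm (D\<psi> x))\<^sup>2 \<partial>lebesgue_on \<Omega>)"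
      unfolding P_def by (rule coercive[OF L\<psi>(2)])
    finally show "(\<integral>x. a (l_op \<Omega> g r (u r) x) * (norm (D\<psi> x))\<^sup>2 \<partial>lebesgue_on \<Omega>)
        - (\<integral>x. a' (l_op \<Omega> g r (u r) x) * l_op \<Omega> g r \<psi> x * (Du r x \<bullet> D\<psi> x) \<partial>lebesgue_on \<Omega>) \<ge> 0"
      unfolding l_def by linarith
  qed
qed

end
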